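(* (i) Among smooth functions $f$ belonging to the case (C), the lower estimate $m_0(f)\ge 1/a$ is optimal; that is, there exists a smooth function $f$ belonging to the case (C) (for some $a\le b$) such that $m_0(f)=1/a$. (ii) Among smooth functions $f$ belonging to the case (D), the lower estimate $m_0(f)\ge 1/b$ is optimal; that is, there exists a smooth function $f$ belonging to the case (D) (for some $a\le b$) such that $m_0(f)=1/b$.
   Context: Let $U$ be a sufficiently small open neighborhood of the origin in $\mathbb{R}^2$ and $a\le b$ nonnegative integers. A smooth function defined near the origin is flat at the origin if all its derivatives vanish there. A real-valued smooth function $f$ on $U$ with $f(0,0)=0$, $\nabla f(0,0)=0$ belongs to case (C) if $f(x,y)=v(x,y)x^ay^b+h(x,y)$ on $U$, and to case (D) if $f(x,y)=v(x,y)x^ay^b+g(x,y)+h(x,y)$ on $U$, where $v,g,h$ are smooth on $U$, $v(0,0)\neq0$, and $g,h$ are non-zero flat functions of the forms $g(x,y)=\sum_{j=0}^{b-1}y^jg_j(x)$, $h(x,y)=\sum_{j=0}^{a-1}x^jh_j(y)$ with $g_j,h_j$ flat at the origin. For $\varphi\in C_0^\infty(U)$ (smooth, compact support in $U$, real-valued), $Z_f(\varphi)(s)=\int_{\mathbb{R}^2}|f(x,y)|^s\varphi(x,y)\,dx\,dy$, holomorphic on $\mathrm{Re}(s)>0$. Put $$m_0(f,\varphi):=\sup\{\rho>0: Z_f(\varphi)\text{ can be meromorphically continued to a domain containing } \mathrm{Re}(s)>-\rho\},$$ $$m_0(f):=\inf\{m_0(f,\varphi):\varphi\in C_0^\infty(U)\}.$$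 It is known that $m_0(f)\ge 1/a$ for all $f$ in case (C) and $m_0(f)\ge 1/b$ for all $f$ in case (D). Optimality of such an estimate means that some $f$ of the given form attains the lower bound. *)

theory Defs
  imports "HOL-Complex_Analysis.Complex_Analysis"
begin

text \<open>
  Iterated directional derivatives; the empty list of directions gives the function itself.
  On functions of one real variable and on functions on the plane, taking the directions from the
  standard basis gives the usual derivatives and partial derivatives.
\<close>

fun dir_derivs :: "'a::real_normed_vector list \<Rightarrow> ('a \<Rightarrow> 'b::real_normed_vector) \<Rightarrow> 'a \<Rightarrow> 'b" where
  "dir_derivs [] f = f"
| "dir_derivs (v # vs) f = dir_derivs vs (\<lambda>x. frechet_derivative f (at x) v)"

text \<open>
  Smoothness (infinite differentiability), meant for open sets only. Differentiability of all the
  derivatives makes them continuous as well. On an open set the values of the total function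
  \<open>f\<close> outside that set play no role.
\<close>

definition smooth_on :: "'a::real_normed_vector set \<Rightarrow> ('a \<Rightarrow> 'b::real_normed_vector) \<Rightarrow> bool" where
  "smooth_on S f \<longleftrightarrow> (\<forall>vs. \<forall>x\<in>S. dir_derivs vs f differentiable (at x))"

text \<open>The derivatives include the one of order zero, so a flat function vanishes at the origin.\<close>

definition flat :: "('a::real_normed_vector \<Rightarrow> real) \<Rightarrow> bool" where
  "flat f \<longleftrightarrow> (\<exists>W. open W \<and> 0 \<in> W \<and> smooth_on W f) \<and> (\<forall>vs. dir_derivs vs f 0 = 0)"

text \<open>
  Non-zero smooth flat functions \<open>g(x,y) = \<Sum>j<b. y\<^sup>j g\<^sub>j(x)\<close> and
  \<open>h(x,y) = \<Sum>j<a. x\<^sup>j h\<^sub>j(y)\<close> on \<open>U\<close>. The coefficient functions live on the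
  projections of \<open>U\<close> to the coordinate axes.
\<close>

definition flat_y_poly :: "(real \<times> real) set \<Rightarrow> nat \<Rightarrow> (real \<times> real \<Rightarrow> real) \<Rightarrow> bool" where
  "flat_y_poly U b g \<longleftrightarrow>
     smooth_on U g \<and> flat g \<and> (\<exists>p\<in>U. g p \<noteq> 0) \<and>
     (\<exists>c :: nat \<Rightarrow> real \<Rightarrow> real.
        (\<forall>j<b. smooth_on (fst ` U) (c j) \<and> flat (c j)) \<and>
        (\<forall>(x, y)\<in>U. g (x, y) = (\<Sum>j<b. y ^ j * c j x)))"

definition flat_x_poly :: "(real \<times> real) set \<Rightarrow> nat \<Rightarrow> (real \<times> real \<Rightarrow> real) \<Rightarrow> bool" where
  "flat_x_poly U a h \<longleftrightarrow>
     smooth_on U h \<and> flat h \<and> (\<exists>p\<in>U. h p \<noteq> 0) \<and>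
     (\<exists>c :: nat \<Rightarrow> real \<Rightarrow> real.
        (\<forall>j<a. smooth_on (snd ` U) (c j) \<and> flat (c j)) \<and>
        (\<forall>(x, y)\<in>U. h (x, y) = (\<Sum>j<a. x ^ j * c j y)))"

definition singular_at_origin :: "(real \<times> real) set \<Rightarrow> (real \<times> real \<Rightarrow> real) \<Rightarrow> bool" where
  "singular_at_origin U f \<longleftrightarrow>
     smooth_on U f \<and> f (0, 0) = 0 \<and> (f has_derivative (\<lambda>_. 0)) (at (0, 0))"

definition case_C :: "(real \<times> real) set \<Rightarrow> nat \<Rightarrow> nat \<Rightarrow> (real \<times> real \<Rightarrow> real) \<Rightarrow> bool" where
  "case_C U a b f \<longleftrightarrow>
     a \<le> b \<and> singular_at_origin U f \<and>
     (\<exists>v h. smooth_on U v \<and> v (0, 0) \<noteq> 0 \<and> flat_x_poly U a h \<and>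
        (\<forall>(x, y)\<in>U. f (x, y) = v (x, y) * x ^ a * y ^ b + h (x, y)))"

definition case_D :: "(real \<times> real) set \<Rightarrow> nat \<Rightarrow> nat \<Rightarrow> (real \<times> real \<Rightarrow> real) \<Rightarrow> bool" where
  "case_D U a b f \<longleftrightarrow>
     a \<le> b \<and> singular_at_origin U f \<and>
     (\<exists>v g h. smooth_on U v \<and> v (0, 0) \<noteq> 0 \<and> flat_y_poly U b g \<and> flat_x_poly U a h \<and>
        (\<forall>(x, y)\<in>U. f (x, y) = v (x, y) * x ^ a * y ^ b + g (x, y) + h (x, y)))"

definition test_functions :: "(real \<times> real) set \<Rightarrow> (real \<times> real \<Rightarrow> real) set" where
  "test_functions U =
     {\<phi>. smooth_on UNIV \<phi> \<and> compact (closure {p. \<phi> p \<noteq> 0}) \<and> closure {p. \<phi> p \<noteq> 0} \<subseteq> U}"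

text \<open>
  Only used for \<open>Re s > 0\<close>, where \<open>0 powr s = 0\<close> is the usual value. Outside the support of
  \<open>\<phi>\<close> the integrand vanishes, whatever the total function \<open>f\<close> is there.
\<close>

definition Zeta :: "(real \<times> real \<Rightarrow> real) \<Rightarrow> (real \<times> real \<Rightarrow> real) \<Rightarrow> complex \<Rightarrow> complex" where
  "Zeta f \<phi> s = (LINT p|lborel. complex_of_real \<bar>f p\<bar> powr s * complex_of_real (\<phi> p))"

definition meromorphically_continuable ::
    "(real \<times> real \<Rightarrow> real) \<Rightarrow> (real \<times> real \<Rightarrow> real) \<Rightarrow> real \<Rightarrow> bool" where
  "meromorphically_continuable f \<phi> \<rho> \<longleftrightarrow>
     (\<exists>D F. open D \<and> connected D \<and> {s. Re s > - \<rho>} \<subseteq> D \<and> F meromorphic_on D \<and>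
        (\<forall>s. Re s > 0 \<longrightarrow> F s = Zeta f \<phi> s))"

text \<open>The supremum may be infinite, for instance for \<open>\<phi> = 0\<close>; hence extended reals.\<close>

definition m0_test :: "(real \<times> real \<Rightarrow> real) \<Rightarrow> (real \<times> real \<Rightarrow> real) \<Rightarrow> ereal" where
  "m0_test f \<phi> = (SUP \<rho> \<in> {\<rho>. \<rho> > 0 \<and> meromorphically_continuable f \<phi> \<rho>}. ereal \<rho>)"

definition m0 :: "(real \<times> real) set \<Rightarrow> (real \<times> real \<Rightarrow> real) \<Rightarrow> ereal" where
  "m0 U f = (INF \<phi> \<in> test_functions U. m0_test f \<phi>)"

text \<open>A property of neighbourhoods of the origin holds for all sufficiently small ones.\<close>

definition for_small_nbhds :: "((real \<times> real) set \<Rightarrow> bool) \<Rightarrow> bool" where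
  "for_small_nbhds P \<longleftrightarrow>
     (\<exists>U\<^sub>0. open U\<^sub>0 \<and> (0, 0) \<in> U\<^sub>0 \<and> (\<forall>U. open U \<and> (0, 0) \<in> U \<and> U \<subseteq> U\<^sub>0 \<longrightarrow> P U))"

end

theory Submission
  imports Defs
begin

text \<open>
  Both bounds are attained with \<open>a = b = 2\<close>, by
  \<open>f(x,y) = x\<^sup>2 y\<^sup>2 + e(y)\<close> in case (C) and \<open>f(x,y) = x\<^sup>2 y\<^sup>2 + e(x) + e(y)\<close> in case (D), where
  \<open>e(t) = exp (- 1 / t\<^sup>2)\<close>.

  Since \<open>f \<ge> x\<^sup>2 y\<^sup>2\<close>, the integral defining the zeta function converges for \<open>Re s > -1/2\<close> and is
  holomorphic there (\<open>Zeta_holomorphic\<close>), whatever the test function is. This gives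
  \<open>m\<^sub>0(f) \<ge> 1/2\<close> directly.

  For the opposite inequality one test function suffices, a bump multiplied by \<open>y\<^sup>2\<close>. Let
  \<open>s = -1/2 + \<delta>\<close> tend to \<open>-1/2\<close> from the right. Up to a factor of about \<open>1 / \<bar>y\<bar>\<close>, the integral
  of \<open>f\<^sup>s\<close> over \<open>x\<close> for fixed \<open>y\<close> would be of size \<open>1/\<delta>\<close> without the flat term. The flat term
  cuts this off at size \<open>log (1/e(y)) = 1/y\<^sup>2\<close>. As \<open>y\<close> tends to \<open>0\<close> the cutoff is lost so fast that,
  in spite of the factor \<open>y\<^sup>2\<close> of the test function, the integral over both variables diverges at
  \<open>s = -1/2\<close> (\<open>mass_at_critical_exponent_infinite\<close>). On the other hand, growth of order \<open>1/\<delta>\<close> can come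
  only from an arbitrarily narrow strip around \<open>y = 0\<close>, where the factor \<open>y\<^sup>2\<close> makes its coefficient
  small (\<open>mass_near_critical_exponent\<close>). So the zeta function is unbounded near \<open>-1/2\<close>, yet grows more
  slowly than \<open>1/\<delta>\<close>. No function that is meromorphic at \<open>-1/2\<close> does that
  (\<open>meromorphic_Bseq_if_slower_than_pole\<close>): if it is unbounded there, it has a pole, and at a pole it
  grows at least like \<open>1/\<delta>\<close>. By the identity theorem a meromorphic continuation across \<open>-1/2\<close>
  would agree with the integral to the right of \<open>-1/2\<close>, so there is none.

  Besides continuity the argument uses only two inequalities for \<open>f\<close>. They are collected in the
  locale \<open>flat_perturbation\<close>, so that both cases share one proof.
\<close>

section \<open>Smooth and flat functions built from exponentials\<close>

text \<open>
  The powers of \<open>t\<close> in the denominator make the family closed under differentiation.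
\<close>

definition exp_tail :: "nat \<Rightarrow> real \<Rightarrow> real" where
  "exp_tail k t = (if t > 0 then exp (- 1 / t) / t ^ k else 0)"

lemma exp_tail_nonneg: "0 \<le> exp_tail k t"
  by (simp add: exp_tail_def)

lemma exp_tail_pos_iff: "0 < exp_tail k t \<longleftrightarrow> 0 < t"
  by (simp add: exp_tail_def)

lemma exp_tail_nonpos [simp]: "t \<le> 0 \<Longrightarrow> exp_tail k t = 0"
  by (simp add: exp_tail_def)

lemma exp_tail_0_le_1: "exp_tail 0 t \<le> 1"
  by (simp add: exp_tail_def)

lemma exp_tail_0_mono: "s \<le> t \<Longrightarrow> exp_tail 0 s \<le> exp_tail 0 t"
  by (auto simp: exp_tail_def frac_le)

lemma exp_ge_power_div_fact:
  fixes u :: real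
  assumes "0 \<le> u"
  shows "u ^ n / fact n \<le> exp u"
proof -
  have "(\<Sum>i\<in>{n}. inverse (fact i) * u ^ i) \<le> (\<Sum>i. inverse (fact i) * u ^ i)"
    by (rule sum_le_suminf) (use assms in \<open>auto intro: summable_exp\<close>)
  then show ?thesis
    by (simp add: exp_def divide_inverse mult.commute)
qed

text \<open>
  The exponential series gives \<open>exp (1/t) \<ge> (1/t)\<^sup>k\<^sup>+\<^sup>2 / (k+2)!\<close>. Vanishing to second order is what
  differentiability at \<open>0\<close> requires, and for \<open>k = 0\<close> the bound also compares the flat terms with
  monomials.
\<close>

lemma exp_tail_le: "exp_tail k t \<le> fact (k + 2) * t\<^sup>2"
proof (cases "t > 0")
  case True
  have "(1 / t) ^ (k + 2) / fact (k + 2) \<le> exp (1 / t)"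
    by (rule exp_ge_power_div_fact) (use True in auto)
  then have "1 \<le> exp (1 / t) * (fact (k + 2) * t ^ (k + 2))"
    using True by (simp add: field_simps del: fact_Suc)
  then have "exp (- 1 / t) \<le> fact (k + 2) * t ^ (k + 2)"
    using True by (simp add: exp_minus field_simps del: fact_Suc)
  then show ?thesis
    using True by (simp add: exp_tail_def field_simps power_add power2_eq_square del: fact_Suc)
qed auto

lemma exp_tail_has_field_derivative:
  "(exp_tail k has_field_derivative exp_tail (k + 2) t - real k * exp_tail (k + 1) t) (at t)"
proof -
  consider "t > 0" | "t < 0" | "t = 0" by linarith
  then show ?thesis
  proof cases
    case 1
    have "((\<lambda>t. exp (- 1 / t) / t ^ k) has_field_derivative
        exp_tail (k + 2) t - real k * exp_tail (k + 1) t) (at t)"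
    proof (cases k)
      case 0
      show ?thesis
        unfolding 0 by (rule derivative_eq_intros refl | use 1 in \<open>simp add: exp_tail_def field_simps power2_eq_square\<close>)+
    next
      case (Suc j)
      show ?thesis
        unfolding Suc by (rule derivative_eq_intros refl | use 1 in \<open>simp add: exp_tail_def field_simps power2_eq_square\<close>)+
    qed
    then show ?thesis
      by (rule has_field_derivative_transform_within_open[of _ _ _ "{0<..}"])
        (use 1 in \<open>auto simp: exp_tail_def\<close>)
  next
    case 2
    have "((\<lambda>_. 0) has_field_derivative exp_tail (k + 2) t - real k * exp_tail (k + 1) t) (at t)"
      using 2 by simp
    then show ?thesis
      by (rule has_field_derivative_transform_within_open[of _ _ _ "{..<0}"])
        (use 2 in auto)
  next
    case 3
    have "((\<lambda>h. exp_tail k h / h) \<longlongrightarrow> 0) (at 0)"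
    proof (rule Lim_null_comparison)
      show "\<forall>\<^sub>F h in at 0. norm (exp_tail k h / h) \<le> fact (k + 2) * \<bar>h\<bar>"
      proof (intro always_eventually allI)
        fix h :: real
        have "exp_tail k h \<le> fact (k + 2) * \<bar>h\<bar> * \<bar>h\<bar>"
          using exp_tail_le[of k h] by (simp add: power2_eq_square mult.assoc del: fact_Suc)
        then show "norm (exp_tail k h / h) \<le> fact (k + 2) * \<bar>h\<bar>"
          by (cases "h = 0") (simp_all add: exp_tail_nonneg pos_divide_le_eq del: fact_Suc)
      qed
      have "((\<lambda>h. fact (k + 2) * \<bar>h\<bar>) \<longlongrightarrow> fact (k + 2) * \<bar>0\<bar>) (at (0::real))"
        by (intro tendsto_intros)
      then show "((\<lambda>h. fact (k + 2) * \<bar>h\<bar>) \<longlongrightarrow> 0) (at (0::real))"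
        by simp
    qed
    then show ?thesis
      using 3 by (simp add: DERIV_def)
  qed
qed

text \<open>
  Smoothness of a concrete function is proved once and for all for an algebra of functions that is
  closed under directional derivatives. The functions that attain the bounds, their flat terms and
  the bump that serves as a test function are all built by its rules.
\<close>

inductive_set exp_algebra :: "('a::real_normed_vector \<Rightarrow> real) set" where
  const: "(\<lambda>_. c) \<in> exp_algebra"
| linear: "bounded_linear l \<Longrightarrow> l \<in> exp_algebra"
| add: "f \<in> exp_algebra \<Longrightarrow> g \<in> exp_algebra \<Longrightarrow> (\<lambda>p. f p + g p) \<in> exp_algebra"
| mult: "f \<in> exp_algebra \<Longrightarrow> g \<in> exp_algebra \<Longrightarrow> (\<lambda>p. f p * g p) \<in> exp_algebra"
| tail: "q \<in> exp_algebra \<Longrightarrow> (\<lambda>p. exp_tail k (q p)) \<in> exp_algebra"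

lemma exp_algebra_diff:
  assumes "f \<in> exp_algebra" "g \<in> exp_algebra"
  shows "(\<lambda>p. f p - g p) \<in> exp_algebra"
  using exp_algebra.add[OF assms(1) exp_algebra.mult[OF exp_algebra.const[of "-1"] assms(2)]]
  by simp

lemma exp_algebra_power:
  assumes "f \<in> exp_algebra"
  shows "(\<lambda>p. f p ^ n) \<in> exp_algebra"
proof (induction n)
  case 0
  show ?case using exp_algebra.const[of 1] by simp
next
  case (Suc n)
  show ?case using exp_algebra.mult[OF assms Suc] by simp
qed

lemma exp_algebra_coordinates:
  "(\<lambda>t. t) \<in> exp_algebra" "fst \<in> exp_algebra" "snd \<in> exp_algebra"
  by (rule exp_algebra.linear bounded_linear_ident bounded_linear_fst bounded_linear_snd)+

lemma exp_tail_comp_has_derivative: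
  assumes "(q has_derivative q') (at x)"
  shows "((\<lambda>p. exp_tail k (q p)) has_derivative
    (\<lambda>v. (exp_tail (k + 2) (q x) - real k * exp_tail (k + 1) (q x)) * q' v)) (at x)"
  by (rule has_derivative_compose[OF assms
        exp_tail_has_field_derivative[THEN has_field_derivative_imp_has_derivative]])

lemma exp_algebra_has_derivative:
  assumes "f \<in> exp_algebra"
  shows "\<exists>f'. (\<forall>x. (f has_derivative f' x) (at x)) \<and> (\<forall>v. (\<lambda>x. f' x v) \<in> exp_algebra)"
  using assms
proof induction
  case (const c)
  show ?case
    by (intro exI[of _ "\<lambda>_ _. 0"]) (auto intro: exp_algebra.const)
next
  case (linear l)
  then show ?case
    by (intro exI[of _ "\<lambda>_. l"])
      (auto intro: exp_algebra.const bounded_linear_imp_has_derivative)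
next
  case (add f g)
  then obtain f' g' where
    "\<forall>x. (f has_derivative f' x) (at x)" "\<forall>v. (\<lambda>x. f' x v) \<in> exp_algebra"
    "\<forall>x. (g has_derivative g' x) (at x)" "\<forall>v. (\<lambda>x. g' x v) \<in> exp_algebra"
    by blast
  then show ?case
    by (intro exI[of _ "\<lambda>x v. f' x v + g' x v"])
      (auto intro: exp_algebra.add has_derivative_add)
next
  case (mult f g)
  then obtain f' g' where
    "\<forall>x. (f has_derivative f' x) (at x)" "\<forall>v. (\<lambda>x. f' x v) \<in> exp_algebra"
    "\<forall>x. (g has_derivative g' x) (at x)" "\<forall>v. (\<lambda>x. g' x v) \<in> exp_algebra"
    by blast
  with mult.hyps show ?case
    by (intro exI[of _ "\<lambda>x v. f x * g' x v + f' x v * g x"])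
      (auto intro!: exp_algebra.add exp_algebra.mult has_derivative_mult)
next
  case (tail q k)
  then obtain q' where
    "\<forall>x. (q has_derivative q' x) (at x)" "\<forall>v. (\<lambda>x. q' x v) \<in> exp_algebra"
    by blast
  then have q: "\<And>x. (q has_derivative q' x) (at x)" "\<And>v. (\<lambda>x. q' x v) \<in> exp_algebra"
    by blast+
  show ?case
  proof (intro exI conjI allI)
    show "((\<lambda>p. exp_tail k (q p)) has_derivative
        (\<lambda>v. (exp_tail (k + 2) (q x) - real k * exp_tail (k + 1) (q x)) * q' x v)) (at x)" for x
      using q(1) by (rule exp_tail_comp_has_derivative)
    show "(\<lambda>x. (exp_tail (k + 2) (q x) - real k * exp_tail (k + 1) (q x)) * q' x v)
        \<in> exp_algebra" for v
      by (intro exp_algebra.mult exp_algebra_diff exp_algebra.tail exp_algebra.const q(2) tail.hyps)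
  qed
qed

lemma exp_algebra_continuous:
  assumes "g \<in> exp_algebra"
  shows "continuous_on S g"
  using exp_algebra_has_derivative[OF assms] has_derivative_continuous
  by (metis continuous_at_imp_continuous_on)

text \<open>
  Iterated derivatives stay in any class that a single derivative does not leave. The class may be an
  algebra of differentiable functions, which yields smoothness, or an ideal of functions vanishing
  at the origin, which yields flatness.
\<close>

lemma dir_derivs_closed:
  assumes "\<And>f v. f \<in> A \<Longrightarrow> (\<lambda>x. frechet_derivative f (at x) v) \<in> A" "f \<in> A"
  shows "dir_derivs vs f \<in> A"
  using assms(2)
proof (induction vs arbitrary: f)
  case Nil
  then show ?case by simp
next
  case (Cons v vs)
  show ?case
    unfolding dir_derivs.simps by (rule Cons.IH) (rule assms(1)[OF Cons.prems])
qed

lemma frechet_derivative_fun_eq: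
  assumes "\<And>x. (f has_derivative f' x) (at x)"
  shows "(\<lambda>x. frechet_derivative f (at x) v) = (\<lambda>x. f' x v)"
  using frechet_derivative_at[OF assms] by simp

lemma exp_algebra_frechet_derivative:
  assumes "f \<in> exp_algebra"
  shows "(\<lambda>x. frechet_derivative f (at x) v) \<in> exp_algebra"
proof -
  obtain f' where f': "\<And>x. (f has_derivative f' x) (at x)" "\<And>v. (\<lambda>x. f' x v) \<in> exp_algebra"
    using exp_algebra_has_derivative[OF assms] by blast
  show ?thesis
    unfolding frechet_derivative_fun_eq[OF f'(1)] by (rule f'(2))
qed

lemma exp_algebra_smooth_on:
  assumes "f \<in> exp_algebra"
  shows "smooth_on S f"
proof -
  have "dir_derivs vs f \<in> exp_algebra" for vs
    by (rule dir_derivs_closed[OF exp_algebra_frechet_derivative assms])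
  then have "dir_derivs vs f differentiable (at x)" for vs x
    using exp_algebra_has_derivative[of "dir_derivs vs f"] unfolding differentiable_def by blast
  then show ?thesis
    unfolding smooth_on_def by blast
qed

text \<open>
  The ideal generated by the \<open>exp_tail k \<circ> q\<close> with \<open>q 0 = 0\<close>. All its elements vanish at
  \<open>0\<close> because \<open>exp_tail k 0 = 0\<close>, and the product and chain rules show that derivatives stay in it.
\<close>

inductive_set flat_ideal :: "('a::real_normed_vector \<Rightarrow> real) set" where
  tail: "q \<in> exp_algebra \<Longrightarrow> q 0 = 0 \<Longrightarrow> g \<in> exp_algebra \<Longrightarrow>
    (\<lambda>p. g p * exp_tail k (q p)) \<in> flat_ideal"
| add: "f \<in> flat_ideal \<Longrightarrow> g \<in> flat_ideal \<Longrightarrow> (\<lambda>p. f p + g p) \<in> flat_ideal"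

lemma flat_ideal_subset_exp_algebra: "f \<in> flat_ideal \<Longrightarrow> f \<in> exp_algebra"
  by (induction rule: flat_ideal.induct) (auto intro: exp_algebra.intros)

lemma flat_ideal_frechet_derivative:
  assumes "f \<in> flat_ideal"
  shows "(\<lambda>x. frechet_derivative f (at x) v) \<in> flat_ideal"
  using assms
proof induction
  case (tail q g k)
  obtain q' where q': "\<And>x. (q has_derivative q' x) (at x)" "\<And>v. (\<lambda>x. q' x v) \<in> exp_algebra"
    using exp_algebra_has_derivative[OF tail(1)] by blast
  obtain g' where g': "\<And>x. (g has_derivative g' x) (at x)" "\<And>v. (\<lambda>x. g' x v) \<in> exp_algebra"
    using exp_algebra_has_derivative[OF tail(3)] by blast
  have "(\<lambda>x. frechet_derivative (\<lambda>p. g p * exp_tail k (q p)) (at x) v) =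
    (\<lambda>x. g x * ((exp_tail (k + 2) (q x) - real k * exp_tail (k + 1) (q x)) * q' x v)
      + g' x v * exp_tail k (q x))"
    by (rule frechet_derivative_fun_eq)
      (intro has_derivative_mult exp_tail_comp_has_derivative q' g')
  also have "\<dots> = (\<lambda>x. ((g x * q' x v) * exp_tail (k + 2) (q x)
      + (- real k * g x * q' x v) * exp_tail (k + 1) (q x)) + g' x v * exp_tail k (q x))"
    by (simp add: algebra_simps)
  also have "\<dots> \<in> flat_ideal"
    by (intro flat_ideal.intros exp_algebra.mult exp_algebra.const q' g' tail)
  finally show ?case .
next
  case (add f g)
  obtain f' where f': "\<And>x. (f has_derivative f' x) (at x)"
    using exp_algebra_has_derivative[OF flat_ideal_subset_exp_algebra] add.hyps by blast
  obtain g' where g': "\<And>x. (g has_derivative g' x) (at x)"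
    using exp_algebra_has_derivative[OF flat_ideal_subset_exp_algebra] add.hyps by blast
  have "(\<lambda>x. frechet_derivative (\<lambda>p. f p + g p) (at x) v) =
    (\<lambda>x. frechet_derivative f (at x) v + frechet_derivative g (at x) v)"
    using frechet_derivative_fun_eq[OF has_derivative_add[OF f' g']]
      frechet_derivative_at[OF f'] frechet_derivative_at[OF g'] by simp
  with flat_ideal.add[OF add.IH] show ?case by simp
qed

lemma flat_ideal_flat:
  assumes "f \<in> flat_ideal"
  shows "flat f"
proof -
  have "f 0 = 0" if "f \<in> flat_ideal" for f :: "'a \<Rightarrow> real"
    using that by induction auto
  moreover have "dir_derivs vs f \<in> flat_ideal" for vs
    by (rule dir_derivs_closed[OF flat_ideal_frechet_derivative assms])
  moreover have "smooth_on UNIV f"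
    using exp_algebra_smooth_on flat_ideal_subset_exp_algebra assms by blast
  ultimately show ?thesis
    unfolding flat_def by blast
qed

section \<open>Holomorphic parameter integrals\<close>

text \<open>
  Local domination of the integrands themselves suffices: Cauchy's inequality turns it into
  domination of the difference quotients, and dominated convergence does the rest.
\<close>

lemma holomorphic_on_integral:
  fixes g :: "complex \<Rightarrow> 'a \<Rightarrow> complex"
  assumes holo: "\<And>x. (\<lambda>z. g z x) holomorphic_on S" and "open S"
    and meas [measurable]: "\<And>z. g z \<in> borel_measurable M"
    and dom: "\<And>z. z \<in> S \<Longrightarrow> \<exists>r>0. \<exists>B. cball z r \<subseteq> S \<and> integrable M B \<and>
      (AE x in M. \<forall>u\<in>cball z r. norm (g u x) \<le> B x)"
  shows "(\<lambda>z. integral\<^sup>L M (g z)) holomorphic_on S"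
proof -
  have "((\<lambda>z. integral\<^sup>L M (g z)) has_field_derivative (LINT x|M. deriv (\<lambda>z. g z x) z)) (at z)"
    if "z \<in> S" for z
  proof -
    obtain r B where r: "r > 0" "cball z r \<subseteq> S" and B: "integrable M B"
      and le: "AE x in M. \<forall>u\<in>cball z r. norm (g u x) \<le> B x"
      using dom[OF \<open>z \<in> S\<close>] by blast
    have int: "integrable M (g u)" if "u \<in> cball z r" for u
      by (rule Bochner_Integration.integrable_bound[OF B])
        (use le that in \<open>auto elim!: eventually_mono intro: order_trans[OF _ abs_ge_self]\<close>)
    have deriv: "((\<lambda>z. g z x) has_field_derivative deriv (\<lambda>z. g z x) u) (at u)" if "u \<in> S" for u x
      using holo[of x] \<open>open S\<close> that by (rule holomorphic_derivI)
    \<comment> \<open>Cauchy's inequality on discs of radius \<open>r/2\<close> bounds the derivatives by the majorant itself.\<close>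
    have cauchy: "norm (deriv (\<lambda>z. g z x) u) \<le> 2 * B x / r"
      if x: "\<forall>u\<in>cball z r. norm (g u x) \<le> B x" and u: "u \<in> cball z (r/2)" for x u
    proof -
      have sub: "cball u (r/2) \<subseteq> cball z r"
      proof
        fix w assume "w \<in> cball u (r/2)"
        with u show "w \<in> cball z r"
          using dist_triangle[of z w u] by simp
      qed
      have h: "(\<lambda>z. g z x) holomorphic_on cball u (r/2)"
        using holo[of x] by (rule holomorphic_on_subset) (use sub r in blast)
      have "norm ((deriv ^^ 1) (\<lambda>z. g z x) u) \<le> fact 1 * B x / (r/2) ^ 1"
      proof (rule Cauchy_inequality)
        show "(\<lambda>z. g z x) holomorphic_on ball u (r/2)"
          using h ball_subset_cball by (rule holomorphic_on_subset)
        show "continuous_on (cball u (r/2)) (\<lambda>z. g z x)"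
          using h by (rule holomorphic_on_imp_continuous_on)
        show "0 < r/2" using r by simp
        fix w assume "norm (u - w) = r/2"
        then have "w \<in> cball u (r/2)" by (simp add: dist_norm)
        then show "norm (g w x) \<le> B x" using sub x by blast
      qed
      then show ?thesis by (simp add: mult.commute)
    qed
    have conv: "(\<lambda>n. integral\<^sup>L M (\<lambda>x. (g (X n) x - g z x) / (X n - z)))
        \<longlonglongrightarrow> (LINT x|M. deriv (\<lambda>z. g z x) z)"
      if X: "\<And>n. X n \<in> cball z (r/2) - {z}" "X \<longlonglongrightarrow> z" for X
    proof (rule integral_dominated_convergence)
      have lim: "(\<lambda>n. (g (X n) x - g z x) / (X n - z)) \<longlonglongrightarrow> deriv (\<lambda>z. g z x) z" for x
      proof -
        have "((\<lambda>w. (g w x - g z x) / (w - z)) \<longlongrightarrow> deriv (\<lambda>z. g z x) z) (at z)"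
          using deriv[OF \<open>z \<in> S\<close>, of x] by (simp add: has_field_derivative_iff)
        then have "((\<lambda>w. (g w x - g z x) / (w - z)) \<circ> X) \<longlonglongrightarrow> deriv (\<lambda>z. g z x) z"
          unfolding tendsto_at_iff_sequentially using X by blast
        then show ?thesis by (simp add: comp_def)
      qed
      show "(\<lambda>x. deriv (\<lambda>z. g z x) z) \<in> borel_measurable M"
        by (rule borel_measurable_LIMSEQ_metric[OF _ lim]) measurable
      show "AE x in M. (\<lambda>n. (g (X n) x - g z x) / (X n - z)) \<longlonglongrightarrow> deriv (\<lambda>z. g z x) z"
        using lim by simp
      show "integrable M (\<lambda>x. 2 * B x / r)"
        using B by simp
      show "AE x in M. norm ((g (X n) x - g z x) / (X n - z)) \<le> 2 * B x / r" for n
        using le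
      proof eventually_elim
        case (elim x)
        have "norm (g (X n) x - g z x) \<le> 2 * B x / r * norm (X n - z)"
        proof (rule field_differentiable_bound[where S = "cball z (r/2)"])
          fix u assume u: "u \<in> cball z (r/2)"
          with r have "u \<in> S" by auto
          then show "((\<lambda>z. g z x) has_field_derivative deriv (\<lambda>z. g z x) u)
            (at u within cball z (r/2))"
            using deriv has_field_derivative_at_within by blast
          show "norm (deriv (\<lambda>z. g z x) u) \<le> 2 * B x / r"
            using cauchy[OF elim u] .
        qed (use X(1)[of n] r in auto)
        moreover have "norm (X n - z) > 0" using X(1)[of n] by auto
        ultimately show ?case by (simp add: norm_divide pos_divide_le_eq)
      qed
    qed measurable
    have quot: "integral\<^sup>L M (\<lambda>x. (g u x - g z x) / (u - z)) =
        (integral\<^sup>L M (g u) - integral\<^sup>L M (g z)) / (u - z)" if "u \<in> cball z (r/2)" for u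
      using int[of u] int[of z] that r by simp
    have "(\<lambda>n. (integral\<^sup>L M (g (X n)) - integral\<^sup>L M (g z)) / (X n - z))
        \<longlonglongrightarrow> (LINT x|M. deriv (\<lambda>z. g z x) z)"
      if X: "\<And>n. X n \<in> cball z (r/2) - {z}" "X \<longlonglongrightarrow> z" for X
    proof -
      have "(\<lambda>n. integral\<^sup>L M (\<lambda>x. (g (X n) x - g z x) / (X n - z))) =
          (\<lambda>n. (integral\<^sup>L M (g (X n)) - integral\<^sup>L M (g z)) / (X n - z))"
        using X(1) by (intro ext quot) auto
      with conv[OF X] show ?thesis by simp
    qed
    then have "((\<lambda>u. (integral\<^sup>L M (g u) - integral\<^sup>L M (g z)) / (u - z))
        \<longlongrightarrow> (LINT x|M. deriv (\<lambda>z. g z x) z)) (at z within cball z (r/2))"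
      unfolding tendsto_at_iff_sequentially comp_def by blast
    moreover have "at z within cball z (r/2) = at z"
      by (rule at_within_interior) (use r in simp)
    ultimately show ?thesis
      by (simp add: has_field_derivative_iff)
  qed
  then show ?thesis
    using \<open>open S\<close> by (auto simp: holomorphic_on_open)
qed

section \<open>Growth of meromorphic functions at a singularity\<close>

text \<open>
  The identity theorem for a meromorphic \<open>F\<close>: deleting the singularities of \<open>F\<close>, a sparse set,
  leaves \<open>S\<close> open and connected. The point \<open>z\<close> may lie on the boundary of \<open>S\<close>; since \<open>F\<close> is
  meromorphic at \<open>z\<close>, the deleted points do not accumulate there.
\<close>

lemma meromorphic_extension_eq_near:
  assumes mero: "F meromorphic_on D" and "open D"
    and holo: "G holomorphic_on S" and S: "open S" "connected S" "S \<subseteq> D"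
    and T: "open T" "T \<subseteq> S" "T \<noteq> {}" "\<And>s. s \<in> T \<Longrightarrow> F s = G s"
    and z: "z \<in> D"
  shows "\<forall>\<^sub>F s in at z. s \<in> S \<longrightarrow> F s = G s"
proof -
  obtain pts where pts: "pts \<subseteq> D" "pts sparse_in D" "F analytic_on D - pts"
    using meromorphic_onE[OF mero] by metis
  have sparse: "pts sparse_in S" using pts(2) S(3) by (rule sparse_in_subset)
  have eq: "F s = G s" if "s \<in> S - pts" for s
  proof (rule analytic_continuation_open[where f = F and g = G and s = "T - pts" and s' = "S - pts"])
    have sparseT: "pts sparse_in T" using sparse T(2) by (rule sparse_in_subset)
    show "open (T - pts)" using open_diff_sparse_pts[OF T(1) sparseT] .
    show "open (S - pts)" using open_diff_sparse_pts[OF S(1) sparse] .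
    show "connected (S - pts)" using S sparse by (intro sparse_imp_connected) auto
    show "T - pts \<noteq> {}"
    proof -
      obtain t where "t \<in> T" using T by blast
      then have "\<forall>\<^sub>F y in at t. y \<notin> pts \<and> y \<in> T"
        using sparseT sparse_in_eventually_iff[OF T(1), of pts] T(1)
        by (intro eventually_conj eventually_at_in_open') (auto simp: \<open>t \<in> T\<close>)
      then have "\<exists>y. y \<notin> pts \<and> y \<in> T"
        by (rule eventually_happens'[OF at_neq_bot])
      then show ?thesis by blast
    qed
    show "F holomorphic_on S - pts"
      by (rule analytic_imp_holomorphic, rule analytic_on_subset[OF pts(3)]) (use S(3) in blast)
    show "G holomorphic_on S - pts"
      using holo by (rule holomorphic_on_subset) auto
  qed (use T that in auto)
  have "\<forall>\<^sub>F s in at z. s \<notin> pts"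
    using pts(2) z sparse_in_eventually_iff[OF \<open>open D\<close>] by blast
  then show ?thesis
    by eventually_elim (use eq in auto)
qed

text \<open>
  At a pole of order \<open>N \<ge> 1\<close> the function grows at least like \<open>1/\<bar>w - z\<bar>\<close>. Growth that is
  slower than this along a single sequence therefore excludes a pole, and without a pole
  a function that is meromorphic at \<open>z\<close> has a limit there.
\<close>

lemma meromorphic_Bseq_if_slower_than_pole:
  assumes "F meromorphic_on {z}" and X: "X \<longlonglongrightarrow> z" "\<And>n. X n \<noteq> z"
    and small: "(\<lambda>n. (X n - z) * F (X n)) \<longlonglongrightarrow> 0"
  shows "Bseq (\<lambda>n. F (X n))"
proof -
  have X': "filterlim X (at z) sequentially"
    using X by (simp add: filterlim_at)
  have "\<not> is_pole F z"
  proof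
    assume pole: "is_pole F z"
    obtain r where r: "r > 0" "F holomorphic_on ball z r - {z}"
      using meromorphic_on_isolated_singularity[OF assms(1)]
      unfolding isolated_singularity_at_def by (auto dest: analytic_imp_holomorphic)
    define N where "N = nat (- zorder F z)"
    define g where "g = zor_poly F z"
    have "zorder F z < 0 \<and> g z \<noteq> 0 \<and> (\<exists>r'>0. cball z r' \<subseteq> ball z r \<and> g holomorphic_on cball z r' \<and>
        (\<forall>w\<in>cball z r' - {z}. F w = g w / (w - z) ^ N \<and> g w \<noteq> 0))"
      using zorder_exist_pole[OF r(2)] r(1) pole unfolding g_def N_def by simp
    then obtain r' where N: "N > 0" and gz: "g z \<noteq> 0" and r': "r' > 0"
      and g: "g holomorphic_on cball z r'" "\<And>w. w \<in> cball z r' - {z} \<Longrightarrow> F w = g w / (w - z) ^ N"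
      unfolding N_def by auto
    have "isCont g z"
      using continuous_on_interior[OF holomorphic_on_imp_continuous_on[OF g(1)], of z] r' by simp
    then have "(\<lambda>n. g (X n)) \<longlonglongrightarrow> g z"
      using X(1) isCont_tendsto_compose by blast
    moreover have "(\<lambda>n. (X n - z) ^ (N - 1) * ((X n - z) * F (X n))) \<longlonglongrightarrow> (z - z) ^ (N - 1) * 0"
      by (intro tendsto_intros X small)
    moreover have "\<forall>\<^sub>F n in sequentially. (X n - z) ^ (N - 1) * ((X n - z) * F (X n)) = g (X n)"
    proof -
      have "\<forall>\<^sub>F n in sequentially. X n \<in> cball z r'"
        using tendstoD[OF X(1) r'] by eventually_elim (simp add: dist_commute)
      then show ?thesis
      proof eventually_elim
        case (elim n)
        have "(X n - z) ^ N = (X n - z) ^ (N - 1) * (X n - z)"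
          by (rule power_minus_mult[OF N, symmetric])
        moreover have "(X n - z) ^ N * F (X n) = g (X n)"
          using g(2)[of "X n"] elim X(2)[of n] by simp
        ultimately show ?case by (simp add: mult.assoc)
      qed
    qed
    ultimately have "g z = (z - z) ^ (N - 1) * 0"
      using LIMSEQ_unique[OF _ Lim_transform_eventually] by blast
    with gz show False by simp
  qed
  then obtain c where "(F \<longlongrightarrow> c) (at z)"
    using meromorphic_on_not_essential[OF assms(1)] unfolding not_essential_def by blast
  then have "(\<lambda>n. F (X n)) \<longlonglongrightarrow> c"
    using X' by (rule filterlim_compose)
  then show ?thesis
    by (intro convergent_imp_Bseq convergentI)
qed

section \<open>Integrals of powers\<close>

lemma nn_integral_abs_powr_le:
  assumes "\<alpha> > -1" "R \<ge> 0"
  shows "(\<integral>\<^sup>+x. ennreal (\<bar>x\<bar> powr \<alpha>) * indicator {-R..R} x \<partial>lborel)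
    \<le> ennreal (2 * R powr (\<alpha> + 1) / (\<alpha> + 1))"
proof -
  define g :: "real \<Rightarrow> ennreal" where "g = (\<lambda>x. ennreal (x powr \<alpha>) * indicator {0..R} x)"
  have g_meas [measurable]: "g \<in> borel_measurable borel"
    unfolding g_def by measurable
  have g: "(\<integral>\<^sup>+x. g x \<partial>lborel) = ennreal (R powr (\<alpha> + 1) / (\<alpha> + 1))"
    unfolding g_def
    by (rule nn_integral_has_integral_lebesgue'[OF _ has_integral_powr_from_0]) (use assms in auto)
  have "(\<integral>\<^sup>+x. ennreal (\<bar>x\<bar> powr \<alpha>) * indicator {-R..R} x \<partial>lborel)
      \<le> (\<integral>\<^sup>+x. g x + g (0 + (-1) * x) \<partial>lborel)"
    by (intro nn_integral_mono) (auto simp: g_def indicator_def)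
  also have "\<dots> = (\<integral>\<^sup>+x. g x \<partial>lborel) + (\<integral>\<^sup>+x. g (0 + (-1) * x) \<partial>lborel)"
    by (intro nn_integral_add) auto
  also have "(\<integral>\<^sup>+x. g (0 + (-1) * x) \<partial>lborel) = (\<integral>\<^sup>+x. g x \<partial>lborel)"
    using nn_integral_real_affine[OF g_meas, of "-1" 0] by simp
  also have "(\<integral>\<^sup>+x. g x \<partial>lborel) + (\<integral>\<^sup>+x. g x \<partial>lborel) = ennreal (2 * R powr (\<alpha> + 1) / (\<alpha> + 1))"
    unfolding g using assms by (simp flip: ennreal_plus)
  finally show ?thesis .
qed

lemma nn_integral_times_lborel:
  fixes u v :: "real \<Rightarrow> ennreal"
  assumes [measurable]: "u \<in> borel_measurable borel" "v \<in> borel_measurable borel"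
  shows "(\<integral>\<^sup>+p. u (fst p) * v (snd p) \<partial>lborel) = (\<integral>\<^sup>+x. u x \<partial>lborel) * (\<integral>\<^sup>+y. v y \<partial>lborel)"
proof -
  have "(\<integral>\<^sup>+p. u (fst p) * v (snd p) \<partial>lborel) = (\<integral>\<^sup>+x. \<integral>\<^sup>+y. u x * v y \<partial>lborel \<partial>lborel)"
    unfolding lborel_prod[symmetric] by (subst lborel.nn_integral_fst[symmetric]) auto
  then show ?thesis
    by (simp add: nn_integral_cmult nn_integral_multc)
qed

lemma nn_integral_abs_powr_prod_le:
  assumes "\<alpha> > -1" "\<beta> > -1" "R \<ge> 0" "S \<ge> 0"
  shows "(\<integral>\<^sup>+p. ennreal (\<bar>fst p\<bar> powr \<alpha> * \<bar>snd p\<bar> powr \<beta>) * indicator ({-R..R} \<times> {-S..S}) p \<partial>lborel)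
    \<le> ennreal (2 * R powr (\<alpha> + 1) / (\<alpha> + 1) * (2 * S powr (\<beta> + 1) / (\<beta> + 1)))"
proof -
  have "(\<integral>\<^sup>+p. ennreal (\<bar>fst p\<bar> powr \<alpha> * \<bar>snd p\<bar> powr \<beta>) * indicator ({-R..R} \<times> {-S..S}) p \<partial>lborel)
    = (\<integral>\<^sup>+p. (ennreal (\<bar>fst p\<bar> powr \<alpha>) * indicator {-R..R} (fst p)) *
        (ennreal (\<bar>snd p\<bar> powr \<beta>) * indicator {-S..S} (snd p)) \<partial>lborel)"
    by (intro nn_integral_cong) (auto simp: indicator_def ennreal_mult)
  also have "\<dots> \<le> ennreal (2 * R powr (\<alpha> + 1) / (\<alpha> + 1)) * ennreal (2 * S powr (\<beta> + 1) / (\<beta> + 1))"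
    by (subst nn_integral_times_lborel) (auto intro!: mult_mono nn_integral_abs_powr_le assms)
  also have "\<dots> = ennreal (2 * R powr (\<alpha> + 1) / (\<alpha> + 1) * (2 * S powr (\<beta> + 1) / (\<beta> + 1)))"
    by (rule ennreal_mult[symmetric]) (use assms in auto)
  finally show ?thesis .
qed

lemma AE_lborel_coordinates_nonzero: "AE p in lborel. fst p \<noteq> (0::real) \<and> snd p \<noteq> (0::real)"
proof -
  have "{0} \<times> UNIV \<in> null_sets (lborel \<Otimes>\<^sub>M lborel :: (real \<times> real) measure)"
    "UNIV \<times> {0} \<in> null_sets (lborel \<Otimes>\<^sub>M lborel :: (real \<times> real) measure)"
    by (auto simp: null_sets_def lborel.emeasure_pair_measure_Times)
  then have "AE p in lborel. p \<notin> {0::real} \<times> (UNIV::real set)"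
    "AE p in lborel. p \<notin> (UNIV::real set) \<times> {0::real}"
    unfolding lborel_prod by (auto intro: AE_not_in)
  then show ?thesis
    by eventually_elim auto
qed

lemma nn_integral_inverse_infinite:
  assumes "0 < b"
  shows "(\<integral>\<^sup>+y. ennreal (1 / y) * indicator {0<..b} y \<partial>lborel) = \<infinity>"
proof -
  have "of_nat n \<le> (\<integral>\<^sup>+y. ennreal (1 / y) * indicator {0<..b} y \<partial>lborel)" for n
  proof -
    have "(\<integral>\<^sup>+y. ennreal (1 / y) * indicator {b * exp (- real n)..b} y \<partial>lborel)
        = ennreal (ln b - ln (b * exp (- real n)))"
    proof (rule nn_integral_FTC_Icc)
      fix y assume "y \<in> {b * exp (- real n)..b}"
      then have "0 < y" using assms by (auto intro: less_le_trans[rotated])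
      then show "(ln has_real_derivative 1 / y) (at y)" "0 \<le> 1 / y"
        by (auto intro: DERIV_ln_divide)
    qed (use assms in \<open>auto simp: mult_le_cancel_left1\<close>)
    also have "ennreal (ln b - ln (b * exp (- real n))) = of_nat n"
      using assms by (simp add: ln_mult ennreal_of_nat_eq_real_of_nat)
    finally have "of_nat n = (\<integral>\<^sup>+y. ennreal (1 / y) * indicator {b * exp (- real n)..b} y \<partial>lborel)" ..
    also have "\<dots> \<le> (\<integral>\<^sup>+y. ennreal (1 / y) * indicator {0<..b} y \<partial>lborel)"
    proof (intro nn_integral_mono mult_left_mono)
      fix y :: real
      have "0 < b * exp (- real n)" using assms by simp
      then show "indicator {b * exp (- real n)..b} y \<le> (indicator {0<..b} y :: ennreal)"
        by (simp add: indicator_def)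
    qed auto
    finally show ?thesis .
  qed
  then show ?thesis
    using ennreal_Ex_less_of_nat not_le infinity_ennreal_def less_top by metis
qed

text \<open>
  A majorant of \<open>w powr t\<close> that is uniform in the exponent: for small \<open>w\<close> the worst exponent is the
  lowest one, and there the lower bound \<open>m\<close> takes over; for large \<open>w\<close> the bound \<open>M\<close> does.
\<close>

lemma powr_le_powr_add_powr:
  fixes m w M a b t :: real
  assumes "0 < m" "m \<le> w" "w \<le> M" "1 \<le> M" "a \<le> t" "t \<le> b" "a \<le> 0"
  shows "w powr t \<le> m powr a + M powr \<bar>b\<bar>"
proof (cases "w \<le> 1")
  case True
  have "w powr t \<le> w powr a"
    using assms True by (intro powr_mono') auto
  also have "\<dots> \<le> m powr a"
    using assms by (intro powr_mono2') auto
  finally show ?thesis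
    by (simp add: add_increasing2)
next
  case False
  have "w powr t \<le> w powr \<bar>b\<bar>"
    using assms False by (intro powr_mono) auto
  also have "\<dots> \<le> M powr \<bar>b\<bar>"
    using assms by (intro powr_mono2) auto
  finally show ?thesis
    by (simp add: add_increasing)
qed

lemma square_mult_powr: "(x\<^sup>2 * y\<^sup>2) powr a = \<bar>x\<bar> powr (2 * a) * \<bar>y\<bar> powr (2 * a)" for x y a :: real
proof -
  have "t\<^sup>2 powr a = \<bar>t\<bar> powr (2 * a)" for t :: real
  proof (cases "t = 0")
    case False
    then have "t\<^sup>2 = \<bar>t\<bar> powr 2" by simp
    then show ?thesis by (simp only: powr_powr)
  qed simp
  then show ?thesis
    by (simp add: powr_mult)
qed

lemma holomorphic_on_of_real_powr: "(\<lambda>z. complex_of_real w powr z) holomorphic_on S"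
  by (cases "w = 0") (auto simp: powr_def intro!: holomorphic_intros)

section \<open>Convergence of the zeta function to the right of -1/2\<close>

lemma test_functions_continuous:
  assumes "\<phi> \<in> test_functions U"
  shows "continuous_on UNIV \<phi>"
proof -
  have "dir_derivs [] \<phi> differentiable (at p)" for p
    using assms unfolding test_functions_def smooth_on_def by blast
  then show ?thesis
    by (simp add: continuous_at_imp_continuous_on differentiable_imp_continuous_within)
qed

lemma test_functions_support_box:
  assumes "\<phi> \<in> test_functions U"
  obtains R where "R > 0" "\<And>p. \<phi> p \<noteq> 0 \<Longrightarrow> p \<in> {-R..R} \<times> {-R..R}"
proof -
  have "bounded (closure {p. \<phi> p \<noteq> 0})"
    using assms unfolding test_functions_def by (auto intro: compact_imp_bounded)
  then obtain R where R: "R > 0" "\<And>p. p \<in> closure {p. \<phi> p \<noteq> 0} \<Longrightarrow> norm p \<le> R"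
    unfolding bounded_pos by blast
  have "p \<in> {-R..R} \<times> {-R..R}" if "\<phi> p \<noteq> 0" for p
  proof -
    have "norm p \<le> R"
      by (rule R(2), rule subsetD[OF closure_subset]) (use that in simp)
    moreover have "norm (fst p) \<le> norm p" "norm (snd p) \<le> norm p"
      using norm_fst_le[of "fst p" "snd p"] norm_snd_le[of "snd p" "fst p"] by simp_all
    ultimately have "\<bar>fst p\<bar> \<le> R" "\<bar>snd p\<bar> \<le> R"
      by simp_all
    then show ?thesis
      by (simp add: mem_Times_iff abs_le_iff)
  qed
  with R(1) show ?thesis by (rule that)
qed

lemma continuous_bounded_on_box:
  fixes g :: "real \<times> real \<Rightarrow> real"
  assumes "continuous_on UNIV g"
  obtains M where "M \<ge> 1" "\<And>p. p \<in> {-R..R} \<times> {-R..R} \<Longrightarrow> \<bar>g p\<bar> \<le> M"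
proof -
  have "compact ({-R..R} \<times> {-R..R})"
    by (intro compact_Times compact_Icc)
  then have "bounded (g ` ({-R..R} \<times> {-R..R}))"
    by (intro compact_imp_bounded compact_continuous_image continuous_on_subset[OF assms]) auto
  then obtain B where "\<And>p. p \<in> {-R..R} \<times> {-R..R} \<Longrightarrow> norm (g p) \<le> B"
    unfolding bounded_iff by blast
  then show ?thesis
    by (intro that[of "max 1 B"]) (auto simp: le_max_iff_disj)
qed

lemma integrable_indicator_box: "integrable lborel (indicator ({-R..R} \<times> {-S..S}) :: real \<times> real \<Rightarrow> real)"
proof -
  have "compact ({-R..R} \<times> {-S..S})"
    by (intro compact_Times compact_Icc)
  then show ?thesis
    by (intro integrable_real_indicator emeasure_bounded_finite compact_imp_bounded)
      (simp_all add: borel_compact)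
qed

lemma open_contains_square:
  fixes U :: "(real \<times> real) set"
  assumes "open U" "(0, 0) \<in> U"
  obtains r where "0 < r" "{-r..r} \<times> {-r..r} \<subseteq> U"
proof -
  obtain A B where AB: "open A" "open B" "(0, 0) \<in> A \<times> B" "A \<times> B \<subseteq> U"
    using assms by (rule open_prod_elim)
  then obtain r where r: "0 < r" "cball 0 r \<subseteq> A \<inter> B"
    using open_contains_cball[of "A \<inter> B"] by blast
  have "{-r..r} \<subseteq> cball 0 r" by auto
  with r AB(4) have "{-r..r} \<times> {-r..r} \<subseteq> U" by blast
  with r(1) show ?thesis by (rule that)
qed

text \<open>
  The two bounds determine where the singularity lies. The lower bound controls \<open>f powr \<sigma>\<close>
  for \<open>\<sigma> < 0\<close> from above, in two ways: by the monomial, whose powers are locally integrable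
  for \<open>\<sigma> > -1/2\<close>, and away from the \<open>x\<close>-axis by a positive constant. The upper bound says that \<open>f\<close> is
  comparable to the monomial \<open>x\<^sup>2 y\<^sup>2\<close> in the cusp \<open>exp (- 1 / (4 y\<^sup>2)) \<le> x \<le> y\<close>.
\<close>

locale flat_perturbation =
  fixes f :: "real \<times> real \<Rightarrow> real"
  assumes continuous: "continuous_on UNIV f"
    and lower: "x\<^sup>2 * y\<^sup>2 + exp_tail 0 (y\<^sup>2) \<le> f (x, y)"
    and upper: "exp (- 1 / (4 * y\<^sup>2)) \<le> x \<Longrightarrow> 0 < y \<Longrightarrow> x \<le> y \<Longrightarrow> f (x, y) \<le> 4 * (x\<^sup>2 * y\<^sup>2)"
begin

lemma measurable_f [measurable]: "f \<in> borel_measurable borel"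
  using continuous by (rule borel_measurable_continuous_onI)

lemma square_le: "(fst p)\<^sup>2 * (snd p)\<^sup>2 \<le> f p"
  using lower[of "fst p" "snd p"] exp_tail_nonneg[of 0 "(snd p)\<^sup>2"] by simp

lemma tail_le: "exp_tail 0 ((snd p)\<^sup>2) \<le> f p"
  by (rule order_trans[OF _ lower[of "fst p" "snd p", unfolded prod.collapse]]) simp

lemma nonneg: "0 \<le> f p"
  using exp_tail_nonneg tail_le order_trans by blast

lemma norm_powr: "norm (complex_of_real \<bar>f p\<bar> powr s * complex_of_real c) = f p powr Re s * \<bar>c\<bar>"
  using nonneg[of p] by (simp add: norm_mult norm_powr_real_powr)

text \<open>
  The majorant holds only off the coordinate axes: where \<open>x y = 0\<close>, the convention \<open>0 powr a = 0\<close>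
  makes the power of the monomial vanish although \<open>f\<close> may be positive.
\<close>

lemma integrand_dominated:
  assumes \<phi>: "\<phi> \<in> test_functions U" and a: "a > -1/2"
  obtains B where "integrable lborel B"
    "AE p in lborel. \<forall>s. a \<le> Re s \<and> Re s \<le> b \<longrightarrow>
      norm (complex_of_real \<bar>f p\<bar> powr s * complex_of_real (\<phi> p)) \<le> B p"
proof -
  obtain R where R: "R > 0" "\<And>p. \<phi> p \<noteq> 0 \<Longrightarrow> p \<in> {-R..R} \<times> {-R..R}"
    using test_functions_support_box[OF \<phi>] by blast
  obtain K where K: "K \<ge> 1" "\<And>p. p \<in> {-R..R} \<times> {-R..R} \<Longrightarrow> \<bar>\<phi> p\<bar> \<le> K"
    using continuous_bounded_on_box[OF test_functions_continuous[OF \<phi>]] by blast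
  obtain M where M: "M \<ge> 1" "\<And>p. p \<in> {-R..R} \<times> {-R..R} \<Longrightarrow> \<bar>f p\<bar> \<le> M"
    using continuous_bounded_on_box[OF continuous] by blast
  (* The majorant of the powers needs a nonpositive lowest exponent. *)
  define c where "c = min a 0"
  have c: "c \<le> a" "c \<le> 0" "2 * c > -1" using a by (auto simp: c_def)
  define P where "P = (\<lambda>p. \<bar>fst p\<bar> powr (2 * c) * \<bar>snd p\<bar> powr (2 * c) *
    indicator ({-R..R} \<times> {-R..R}) p :: real)"
  have "integrable lborel P"
  proof (rule integrableI_bounded)
    show "P \<in> borel_measurable lborel"
      unfolding P_def lborel_prod[symmetric] by measurable
    have "(\<integral>\<^sup>+p. ennreal (norm (P p)) \<partial>lborel) =
      (\<integral>\<^sup>+p. ennreal (\<bar>fst p\<bar> powr (2 * c) * \<bar>snd p\<bar> powr (2 * c)) * indicator ({-R..R} \<times> {-R..R}) p \<partial>lborel)"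
      by (intro nn_integral_cong) (simp add: P_def indicator_def)
    also have "\<dots> < \<infinity>"
      by (rule le_less_trans[OF nn_integral_abs_powr_prod_le]) (use c R in auto)
    finally show "(\<integral>\<^sup>+p. ennreal (norm (P p)) \<partial>lborel) < \<infinity>" .
  qed
  then have "integrable lborel (\<lambda>p. K * (P p + M powr \<bar>b\<bar> * indicator ({-R..R} \<times> {-R..R}) p))"
    by (intro integrable_mult_right Bochner_Integration.integrable_add integrable_indicator_box)
  moreover have "AE p in lborel. \<forall>s. a \<le> Re s \<and> Re s \<le> b \<longrightarrow>
      norm (complex_of_real \<bar>f p\<bar> powr s * complex_of_real (\<phi> p))
      \<le> K * (P p + M powr \<bar>b\<bar> * indicator ({-R..R} \<times> {-R..R}) p)"
    using AE_lborel_coordinates_nonzero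
  proof eventually_elim
    case (elim p)
    show ?case
    proof (intro allI impI)
      fix s assume s: "a \<le> Re s \<and> Re s \<le> b"
      show "norm (complex_of_real \<bar>f p\<bar> powr s * complex_of_real (\<phi> p))
        \<le> K * (P p + M powr \<bar>b\<bar> * indicator ({-R..R} \<times> {-R..R}) p)"
      proof (cases "\<phi> p = 0")
        case True
        then show ?thesis using K(1) by (simp add: P_def)
      next
        case False
        then have box: "p \<in> {-R..R} \<times> {-R..R}" by (rule R(2))
        have "f p powr Re s \<le> ((fst p)\<^sup>2 * (snd p)\<^sup>2) powr c + M powr \<bar>b\<bar>"
          by (rule powr_le_powr_add_powr)
            (use elim s c M(1) M(2)[OF box] square_le[of p] in auto)
        also have "\<dots> = P p + M powr \<bar>b\<bar> * indicator ({-R..R} \<times> {-R..R}) p"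
          using box by (simp add: P_def square_mult_powr)
        finally have "f p powr Re s * \<bar>\<phi> p\<bar> \<le> (P p + M powr \<bar>b\<bar> * indicator ({-R..R} \<times> {-R..R}) p) * K"
          using K(2)[OF box] by (intro mult_mono) (auto simp: P_def)
        then show ?thesis
          unfolding norm_powr by (simp only: mult.commute)
      qed
    qed
  qed
  ultimately show ?thesis by (rule that)
qed

lemma measurable_integrand:
  assumes "\<phi> \<in> test_functions U"
  shows "(\<lambda>p. complex_of_real \<bar>f p\<bar> powr s * complex_of_real (\<phi> p)) \<in> borel_measurable lborel"
proof -
  have [measurable]: "\<phi> \<in> borel_measurable borel"
    by (rule borel_measurable_continuous_onI[OF test_functions_continuous[OF assms]])
  show ?thesis unfolding powr_def by measurable
qed

text \<open>
  For every test function the integral converges up to \<open>Re s = -1/2\<close>, where the monomial majorant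
  \<open>\<bar>x y\<bar> powr (2 * Re s)\<close> stops being integrable.
\<close>

lemma Zeta_holomorphic:
  assumes \<phi>: "\<phi> \<in> test_functions U"
  shows "Zeta f \<phi> holomorphic_on {s. Re s > -1/2}"
proof -
  have "(\<lambda>s. LINT p|lborel. complex_of_real \<bar>f p\<bar> powr s * complex_of_real (\<phi> p))
    holomorphic_on {s. Re s > -1/2}"
  proof (rule holomorphic_on_integral)
    show "(\<lambda>s. complex_of_real \<bar>f p\<bar> powr s * complex_of_real (\<phi> p))
      holomorphic_on {s. Re s > -1/2}" for p
      by (intro holomorphic_intros holomorphic_on_of_real_powr)
    show "open {s. Re s > -1/2}" by (rule open_halfspace_Re_gt)
    show "(\<lambda>p. complex_of_real \<bar>f p\<bar> powr s * complex_of_real (\<phi> p)) \<in> borel_measurable lborel" for s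
      using \<phi> by (rule measurable_integrand)
    fix z :: complex assume z: "z \<in> {s. Re s > -1/2}"
    define r where "r = (Re z + 1/2) / 2"
    have r: "r > 0" "Re z - r > -1/2" using z by (auto simp: r_def field_simps)
    have Re: "Re z - r \<le> Re u \<and> Re u \<le> Re z + r" if "u \<in> cball z r" for u
    proof -
      have "\<bar>Re (z - u)\<bar> \<le> r"
        using abs_Re_le_cmod[of "z - u"] that by (simp only: mem_cball dist_norm)
      then show ?thesis
        by (simp only: minus_complex.sel abs_le_iff) linarith
    qed
    obtain B where B: "integrable lborel B"
      "AE p in lborel. \<forall>s. Re z - r \<le> Re s \<and> Re s \<le> Re z + r \<longrightarrow>
        norm (complex_of_real \<bar>f p\<bar> powr s * complex_of_real (\<phi> p)) \<le> B p"
      using integrand_dominated[OF \<phi> r(2)] by blast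
    have "cball z r \<subseteq> {s. Re s > -1/2}"
      using Re r(2) by force
    moreover have "AE p in lborel. \<forall>u\<in>cball z r.
        norm (complex_of_real \<bar>f p\<bar> powr u * complex_of_real (\<phi> p)) \<le> B p"
      using B(2) by eventually_elim (use Re in blast)
    ultimately show "\<exists>r>0. \<exists>B. cball z r \<subseteq> {s. Re s > -1/2} \<and> integrable lborel B \<and>
        (AE p in lborel. \<forall>u\<in>cball z r. norm (complex_of_real \<bar>f p\<bar> powr u * complex_of_real (\<phi> p)) \<le> B p)"
      using r(1) B(1) by blast
  qed
  then show ?thesis by (simp add: Zeta_def[abs_def])
qed

lemma m0_test_ge:
  assumes "\<phi> \<in> test_functions U"
  shows "ereal (1/2) \<le> m0_test f \<phi>"
proof -
  have open_half: "open {s. Re s > -(1/2)}" by (rule open_halfspace_Re_gt)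
  have "Zeta f \<phi> meromorphic_on {s. Re s > -(1/2)}"
    using Zeta_holomorphic[OF assms] open_half
    by (intro analytic_on_imp_meromorphic_on) (simp add: analytic_on_open)
  moreover have "connected {s. Re s > -(1/2)}"
    by (intro convex_connected convex_halfspace_Re_gt)
  ultimately have "meromorphically_continuable f \<phi> (1/2)"
    unfolding meromorphically_continuable_def using open_half by blast
  then show ?thesis
    unfolding m0_test_def by (intro SUP_upper) auto
qed

end

section \<open>A test function that vanishes on an axis\<close>

text \<open>
  A bump function on a square times \<open>y\<^sup>2\<close>. The factor \<open>y\<^sup>2\<close> damps the integrand near the \<open>x\<close>-axis
  so that the flat perturbation, and not the crossing of the axes, decides how the zeta function
  behaves at \<open>-1/2\<close>.
\<close>

definition bump :: "real \<Rightarrow> real \<times> real \<Rightarrow> real" where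
  "bump r p = (snd p)\<^sup>2 * (exp_tail 0 (r\<^sup>2 - (fst p)\<^sup>2) * exp_tail 0 (r\<^sup>2 - (snd p)\<^sup>2))"

lemma bump_nonneg: "0 \<le> bump r p"
  by (simp add: bump_def exp_tail_nonneg)

lemma bump_le: "bump r p \<le> (snd p)\<^sup>2"
  unfolding bump_def by (intro mult_left_le mult_le_one exp_tail_nonneg exp_tail_0_le_1) simp

lemma bump_support:
  assumes "0 < r" "bump r p \<noteq> 0"
  shows "p \<in> {-r..r} \<times> {-r..r}"
proof -
  have "exp_tail 0 (r\<^sup>2 - (fst p)\<^sup>2) \<noteq> 0" "exp_tail 0 (r\<^sup>2 - (snd p)\<^sup>2) \<noteq> 0"
    using assms(2) by (auto simp: bump_def)
  then have "(fst p)\<^sup>2 \<le> r\<^sup>2" "(snd p)\<^sup>2 \<le> r\<^sup>2"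
    using exp_tail_nonpos by (smt (verit))+
  with assms(1) have "\<bar>fst p\<bar> \<le> r" "\<bar>snd p\<bar> \<le> r"
    by (simp_all add: abs_le_square_iff[symmetric])
  then show ?thesis
    by (simp add: mem_Times_iff abs_le_iff)
qed

lemma bump_test_function:
  assumes "0 < r" "{-r..r} \<times> {-r..r} \<subseteq> U"
  shows "bump r \<in> test_functions U"
proof -
  have "(\<lambda>p. (snd p)\<^sup>2 * (exp_tail 0 (r\<^sup>2 - (fst p)\<^sup>2) * exp_tail 0 (r\<^sup>2 - (snd p)\<^sup>2)))
      \<in> exp_algebra"
    by (intro exp_algebra.mult exp_algebra.tail exp_algebra_diff exp_algebra.const
        exp_algebra_power exp_algebra_coordinates)
  then have "smooth_on UNIV (bump r)"
    using exp_algebra_smooth_on unfolding bump_def[abs_def] by blast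
  moreover have sub: "closure {p. bump r p \<noteq> 0} \<subseteq> {-r..r} \<times> {-r..r}"
    by (intro closure_minimal closed_Times closed_atLeastAtMost) (use bump_support assms(1) in auto)
  moreover have "compact (closure {p. bump r p \<noteq> 0})"
    using sub by (intro compact_Int_closed[OF compact_Times[OF compact_Icc compact_Icc] closed_closure,
          of "-r" r "-r" r "{p. bump r p \<noteq> 0}", unfolded Int_absorb1[OF sub]])
  ultimately show ?thesis
    using assms(2) unfolding test_functions_def by blast
qed

lemma bump_ge:
  assumes "0 < r" "\<bar>x\<bar> \<le> r / 2" "\<bar>y\<bar> \<le> r / 2"
  shows "(exp_tail 0 (r\<^sup>2 / 2))\<^sup>2 * y\<^sup>2 \<le> bump r (x, y)"
proof -
  have *: "exp_tail 0 (r\<^sup>2 / 2) \<le> exp_tail 0 (r\<^sup>2 - t\<^sup>2)" if "\<bar>t\<bar> \<le> r / 2" for t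
  proof (rule exp_tail_0_mono)
    have "t\<^sup>2 \<le> (r / 2)\<^sup>2"
      using that by (metis abs_ge_zero power2_abs power_mono)
    then have "t\<^sup>2 \<le> r\<^sup>2 / 4"
      by (simp add: power_divide)
    then show "r\<^sup>2 / 2 \<le> r\<^sup>2 - t\<^sup>2"
      using zero_le_power2[of r] by linarith
  qed
  have "exp_tail 0 (r\<^sup>2 / 2) * exp_tail 0 (r\<^sup>2 / 2) \<le> exp_tail 0 (r\<^sup>2 - x\<^sup>2) * exp_tail 0 (r\<^sup>2 - y\<^sup>2)"
    by (intro mult_mono * assms exp_tail_nonneg)
  then have "y\<^sup>2 * (exp_tail 0 (r\<^sup>2 / 2) * exp_tail 0 (r\<^sup>2 / 2))
      \<le> y\<^sup>2 * (exp_tail 0 (r\<^sup>2 - x\<^sup>2) * exp_tail 0 (r\<^sup>2 - y\<^sup>2))"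
    by (rule mult_left_mono) simp
  then show ?thesis
    by (simp add: bump_def power2_eq_square mult_ac)
qed

section \<open>Growth of the zeta function at -1/2\<close>

context flat_perturbation
begin

lemma Zeta_of_real:
  "Zeta f \<phi> (complex_of_real \<sigma>) = complex_of_real (LINT p|lborel. f p powr \<sigma> * \<phi> p)"
proof -
  have "complex_of_real \<bar>f p\<bar> powr complex_of_real \<sigma> * complex_of_real (\<phi> p)
      = complex_of_real (f p powr \<sigma> * \<phi> p)" for p
    using nonneg[of p] by (simp add: powr_of_real)
  then show ?thesis
    unfolding Zeta_def by (simp only: integral_complex_of_real)
qed

lemma norm_Zeta_of_real:
  assumes \<phi>: "\<phi> \<in> test_functions U" and "\<And>p. 0 \<le> \<phi> p" and "\<sigma> > -1/2"
  shows "ennreal (norm (Zeta f \<phi> (complex_of_real \<sigma>))) = (\<integral>\<^sup>+p. ennreal (f p powr \<sigma> * \<phi> p) \<partial>lborel)"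
proof -
  obtain B where B: "integrable lborel B"
    "AE p in lborel. \<forall>s. \<sigma> \<le> Re s \<and> Re s \<le> \<sigma> \<longrightarrow>
      norm (complex_of_real \<bar>f p\<bar> powr s * complex_of_real (\<phi> p)) \<le> B p"
    using integrand_dominated[OF \<phi> assms(3)] by blast
  have [measurable]: "\<phi> \<in> borel_measurable borel"
    by (rule borel_measurable_continuous_onI[OF test_functions_continuous[OF \<phi>]])
  have "integrable lborel (\<lambda>p. f p powr \<sigma> * \<phi> p)"
  proof (rule Bochner_Integration.integrable_bound[OF B(1)])
    show "(\<lambda>p. f p powr \<sigma> * \<phi> p) \<in> borel_measurable lborel" by measurable
    show "AE p in lborel. norm (f p powr \<sigma> * \<phi> p) \<le> norm (B p)"
      using B(2)
    proof eventually_elim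
      case (elim p)
      then have "norm (complex_of_real \<bar>f p\<bar> powr complex_of_real \<sigma> * complex_of_real (\<phi> p)) \<le> B p"
        by simp
      then show ?case
        unfolding norm_powr by (simp add: abs_mult)
    qed
  qed
  then have "(\<integral>\<^sup>+p. ennreal (f p powr \<sigma> * \<phi> p) \<partial>lborel) = ennreal (LINT p|lborel. f p powr \<sigma> * \<phi> p)"
    by (rule nn_integral_eq_integral) (use assms(2) in auto)
  moreover have "0 \<le> (LINT p|lborel. f p powr \<sigma> * \<phi> p)"
    by (rule integral_nonneg_AE) (use assms(2) in auto)
  ultimately show ?thesis
    by (simp add: Zeta_of_real)
qed

text \<open>
  In the strip \<open>\<bar>y\<bar> \<le> \<eta>\<close> the monomial bound contributes the factor \<open>1/\<delta>\<close> from the integral over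
  \<open>x\<close>, but only \<open>\<eta>\<^sup>2\<close> from the one over \<open>y\<close>, thanks to the factor \<open>y\<^sup>2\<close> of the bump. Outside the strip \<open>f\<close> is
  bounded below by a constant, whatever \<open>\<delta>\<close> is. Choosing \<open>\<eta>\<close> small first and \<open>\<delta>\<close> small
  afterwards makes \<open>\<delta>\<close> times the integral small.
\<close>

lemma mass_near_critical_exponent:
  assumes r: "0 < r" "r \<le> 1" and \<eta>: "0 < \<eta>" "\<eta> \<le> 1" and \<delta>: "0 < \<delta>" "\<delta> < 1/2"
  shows "(\<integral>\<^sup>+p. ennreal (f p powr (\<delta> - 1/2) * bump r p) \<partial>lborel)
    \<le> ennreal (\<eta>\<^sup>2 / \<delta> + 4 * exp_tail 0 (\<eta>\<^sup>2) powr (-1/2))"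
proof -
  define E where "E = exp_tail 0 (\<eta>\<^sup>2) powr (-1/2)"
  have e: "0 < exp_tail 0 (\<eta>\<^sup>2)"
    using \<eta> by (simp add: exp_tail_pos_iff)
  have "AE p in lborel. ennreal (f p powr (\<delta> - 1/2) * bump r p)
      \<le> ennreal (\<bar>fst p\<bar> powr (2 * \<delta> - 1) * \<bar>snd p\<bar> powr (2 * \<delta> + 1)) * indicator ({-1..1} \<times> {-\<eta>..\<eta>}) p
        + ennreal E * indicator ({-1..1} \<times> {-1..1}) p"
    using AE_lborel_coordinates_nonzero
  proof eventually_elim
    case (elim p)
    obtain x y where p: "p = (x, y)" by (cases p)
    have xy: "x \<noteq> 0" "y \<noteq> 0" using elim p by auto
    show ?case
    proof (cases "bump r p = 0")
      case True
      then show ?thesis by simp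
    next
      case False
      then have box: "x \<in> {-1..1}" "y \<in> {-1..1}"
        using bump_support[OF r(1) False] r(2) by (auto simp: p)
      show ?thesis
      proof (cases "\<bar>y\<bar> \<le> \<eta>")
        case True
        have "f p powr (\<delta> - 1/2) \<le> (x\<^sup>2 * y\<^sup>2) powr (\<delta> - 1/2)"
          using square_le[of p] xy \<delta> by (intro powr_mono2') (auto simp: p)
        also have "\<dots> = \<bar>x\<bar> powr (2 * \<delta> - 1) * \<bar>y\<bar> powr (2 * \<delta> - 1)"
          by (simp add: square_mult_powr algebra_simps)
        finally have "f p powr (\<delta> - 1/2) * bump r p
            \<le> (\<bar>x\<bar> powr (2 * \<delta> - 1) * \<bar>y\<bar> powr (2 * \<delta> - 1)) * y\<^sup>2"
          using bump_le[of r p] by (intro mult_mono) (auto simp: p bump_nonneg)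
        also have "y\<^sup>2 = \<bar>y\<bar> powr 2"
          using xy by simp
        also have "(\<bar>x\<bar> powr (2 * \<delta> - 1) * \<bar>y\<bar> powr (2 * \<delta> - 1)) * \<bar>y\<bar> powr 2
            = \<bar>x\<bar> powr (2 * \<delta> - 1) * \<bar>y\<bar> powr (2 * \<delta> + 1)"
          by (simp only: mult.assoc powr_add[symmetric]) (simp add: add.commute)
        finally have "ennreal (f p powr (\<delta> - 1/2) * bump r p)
            \<le> ennreal (\<bar>x\<bar> powr (2 * \<delta> - 1) * \<bar>y\<bar> powr (2 * \<delta> + 1))"
          by (rule ennreal_leI)
        moreover have "p \<in> {-1..1} \<times> {-\<eta>..\<eta>}"
          using True box by (auto simp: p)
        ultimately show ?thesis
          by (simp add: p add_increasing2)
      next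
        case False
        have "exp_tail 0 (\<eta>\<^sup>2) \<le> exp_tail 0 (y\<^sup>2)"
          using False \<eta> by (intro exp_tail_0_mono) (simp add: abs_le_square_iff[symmetric])
        also have "\<dots> \<le> f p"
          using tail_le[of p] by (simp add: p)
        finally have "f p powr (\<delta> - 1/2) \<le> exp_tail 0 (\<eta>\<^sup>2) powr (\<delta> - 1/2)"
          using e \<delta> by (intro powr_mono2') auto
        also have "\<dots> \<le> E"
          unfolding E_def using \<delta> e exp_tail_0_le_1[of "\<eta>\<^sup>2"] by (intro powr_mono') auto
        finally have "f p powr (\<delta> - 1/2) * bump r p \<le> E * 1"
        proof (rule mult_mono)
          have "y\<^sup>2 \<le> 1" using box by (simp add: abs_square_le_1 abs_le_iff)
          then show "bump r p \<le> 1" using bump_le[of r p] by (simp add: p)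
        qed (auto simp: E_def bump_nonneg)
        then have "ennreal (f p powr (\<delta> - 1/2) * bump r p) \<le> ennreal E"
          by (intro ennreal_leI) simp
        with box show ?thesis
          by (simp add: p add_increasing)
      qed
    qed
  qed
  then have "(\<integral>\<^sup>+p. ennreal (f p powr (\<delta> - 1/2) * bump r p) \<partial>lborel)
      \<le> (\<integral>\<^sup>+p. ennreal (\<bar>fst p\<bar> powr (2 * \<delta> - 1) * \<bar>snd p\<bar> powr (2 * \<delta> + 1)) * indicator ({-1..1} \<times> {-\<eta>..\<eta>}) p
        + ennreal E * indicator ({-1..1} \<times> {-1..1}) p \<partial>lborel)"
    by (rule nn_integral_mono_AE)
  also have "\<dots> = (\<integral>\<^sup>+p. ennreal (\<bar>fst p\<bar> powr (2 * \<delta> - 1) * \<bar>snd p\<bar> powr (2 * \<delta> + 1)) * indicator ({-1..1} \<times> {-\<eta>..\<eta>}) p \<partial>lborel)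
      + (\<integral>\<^sup>+p. ennreal E * indicator ({-1..1} \<times> {-1..1}) p \<partial>(lborel :: (real \<times> real) measure))"
    unfolding lborel_prod[symmetric] by (rule nn_integral_add) measurable
  also have "\<dots> \<le> ennreal (\<eta>\<^sup>2 / \<delta>) + ennreal (4 * E)"
  proof (rule add_mono)
    have "(\<integral>\<^sup>+p. ennreal (\<bar>fst p\<bar> powr (2 * \<delta> - 1) * \<bar>snd p\<bar> powr (2 * \<delta> + 1)) * indicator ({-1..1} \<times> {-\<eta>..\<eta>}) p \<partial>lborel)
      \<le> ennreal (2 * 1 powr (2 * \<delta> - 1 + 1) / (2 * \<delta> - 1 + 1) * (2 * \<eta> powr (2 * \<delta> + 1 + 1) / (2 * \<delta> + 1 + 1)))"
      by (rule nn_integral_abs_powr_prod_le) (use \<delta> \<eta> in auto)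
    also have "\<dots> \<le> ennreal (1 / \<delta> * \<eta>\<^sup>2)"
    proof (intro ennreal_leI mult_mono)
      have "\<eta> powr (2 * \<delta> + 1 + 1) \<le> \<eta> powr 2"
        using \<delta> \<eta> by (intro powr_mono') auto
      then have "\<eta> powr (2 * \<delta> + 1 + 1) \<le> \<eta>\<^sup>2"
        using \<eta> by simp
      moreover have "2 / (2 * \<delta> + 1 + 1) \<le> 1"
        using \<delta> by simp
      ultimately have "2 / (2 * \<delta> + 1 + 1) * \<eta> powr (2 * \<delta> + 1 + 1) \<le> 1 * \<eta>\<^sup>2"
        using \<delta> by (intro mult_mono) auto
      then show "2 * \<eta> powr (2 * \<delta> + 1 + 1) / (2 * \<delta> + 1 + 1) \<le> \<eta>\<^sup>2"
        by simp
    qed (use \<delta> in auto)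
    finally show "(\<integral>\<^sup>+p. ennreal (\<bar>fst p\<bar> powr (2 * \<delta> - 1) * \<bar>snd p\<bar> powr (2 * \<delta> + 1)) * indicator ({-1..1} \<times> {-\<eta>..\<eta>}) p \<partial>lborel)
      \<le> ennreal (\<eta>\<^sup>2 / \<delta>)"
      by simp
    have "(\<integral>\<^sup>+p. ennreal E * indicator ({-1..1} \<times> {-1..1}) p \<partial>(lborel :: (real \<times> real) measure))
        = ennreal E * (2 * 2)"
      unfolding lborel_prod[symmetric]
      by (subst nn_integral_cmult_indicator) (auto simp: lborel.emeasure_pair_measure_Times)
    also have "\<dots> = ennreal (4 * E)"
      by (simp add: ennreal_mult' mult.commute E_def)
    finally show "(\<integral>\<^sup>+p. ennreal E * indicator ({-1..1} \<times> {-1..1}) p \<partial>(lborel :: (real \<times> real) measure))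
        \<le> ennreal (4 * E)"
      by simp
  qed
  also have "\<dots> = ennreal (\<eta>\<^sup>2 / \<delta> + 4 * E)"
    using \<delta> by (simp add: E_def ennreal_plus)
  finally show ?thesis
    unfolding E_def .
qed

end

text \<open>The shift by \<open>3\<close> keeps all the exponents below \<open>0\<close>.\<close>

definition test_exponent :: "nat \<Rightarrow> real" where "test_exponent n = 1 / real (n + 3) - 1/2"

lemma test_exponent: "test_exponent \<longlonglongrightarrow> -1/2" "test_exponent n > -1/2"
proof -
  have "(\<lambda>n. 1 / real (n + 3)) \<longlonglongrightarrow> 0"
    by (rule LIMSEQ_ignore_initial_segment[OF lim_1_over_n])
  then have "(\<lambda>n. 1 / real (n + 3) - 1/2) \<longlonglongrightarrow> 0 - 1/2"
    by (intro tendsto_intros)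
  then show "test_exponent \<longlonglongrightarrow> -1/2" by (simp add: test_exponent_def[abs_def])
qed (simp add: test_exponent_def)

context flat_perturbation
begin

text \<open>
  In the cusp the integrand is at least a constant times \<open>y\<^sup>2 / (x y) = y / x\<close>. Integrating over
  \<open>x\<close> from \<open>exp (- 1 / (4 y\<^sup>2))\<close> to \<open>y\<close> gives about \<open>y \<cdot> 1 / (4 y\<^sup>2)\<close>, and \<open>1 / y\<close> is not
  integrable at \<open>0\<close>. The restriction \<open>r \<le> 1/4\<close> lets the lost term \<open>ln y\<close> be absorbed by half of
  \<open>1 / (4 y\<^sup>2)\<close>.
\<close>

lemma mass_at_critical_exponent_infinite:
  assumes r: "0 < r" "r \<le> 1/4"
  shows "(\<integral>\<^sup>+p. ennreal (f p powr (-1/2) * bump r p) \<partial>lborel) = \<infinity>"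
proof -
  (* On the square of half the size, c bounds both factors of the bump from below. *)
  define c where "c = exp_tail 0 (r\<^sup>2 / 2)"
  have c: "0 < c" using r by (simp add: c_def exp_tail_pos_iff)
  define F where "F = (\<lambda>p. ennreal (f p powr (-1/2) * bump r p))"
  have F_meas: "F \<in> borel_measurable (lborel \<Otimes>\<^sub>M lborel)"
  proof -
    have "{-r..r} \<times> {-r..r} \<subseteq> UNIV" by simp
    then have [measurable]: "bump r \<in> borel_measurable borel"
      by (intro borel_measurable_continuous_onI test_functions_continuous bump_test_function r)
    show ?thesis unfolding lborel_prod F_def by measurable
  qed
  have inner: "ennreal (c\<^sup>2 / 16 * (1 / y)) \<le> (\<integral>\<^sup>+x. F (x, y) \<partial>lborel)" if y: "0 < y" "y \<le> r / 2" for y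
  proof -
    define a where "a = exp (- 1 / (4 * y\<^sup>2))"
    have a: "0 < a" "a \<le> y"
    proof -
      have "1 + 1 / (4 * y\<^sup>2) \<le> exp (1 / (4 * y\<^sup>2))"
        by (rule exp_ge_add_one_self)
      moreover have "1 / y \<le> 1 / (4 * y\<^sup>2)"
        using y r by (simp add: field_simps power2_eq_square)
      ultimately have "1 / y \<le> exp (1 / (4 * y\<^sup>2))" by linarith
      then have "1 / exp (1 / (4 * y\<^sup>2)) \<le> y"
        using y by (simp add: field_simps)
      then show "a \<le> y" by (simp add: a_def exp_minus field_simps)
    qed (simp add: a_def)
    have pointwise: "ennreal (c\<^sup>2 / 2 * y) * (ennreal (1 / x) * indicator {a..y} x) \<le> F (x, y)" for x
    proof (cases "x \<in> {a..y}")
      case True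
      then have x: "0 < x" "a \<le> x" "x \<le> y" using a by auto
      have "0 < f (x, y)"
        using square_le[of "(x, y)"] x y by (auto intro: less_le_trans[of 0 "x\<^sup>2 * y\<^sup>2"])
      then have "(4 * (x\<^sup>2 * y\<^sup>2)) powr (-1/2) \<le> f (x, y) powr (-1/2)"
        using upper[of y x] x y by (intro powr_mono2') (auto simp: a_def)
      moreover have "(4 * (x\<^sup>2 * y\<^sup>2)) powr (-1/2) = 1 / (2 * (x * y))"
        using square_mult_powr[of "2 * x" y "-1/2"] x y
        by (simp add: power_mult_distrib powr_minus_divide mult.assoc)
      ultimately have "1 / (2 * (x * y)) * (c\<^sup>2 * y\<^sup>2) \<le> f (x, y) powr (-1/2) * bump r (x, y)"
        using bump_ge[of r x y] x y r by (intro mult_mono) (auto simp: c_def)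
      moreover have "1 / (2 * (x * y)) * (c\<^sup>2 * y\<^sup>2) = c\<^sup>2 / 2 * y * (1 / x)"
        using x y by (simp add: power2_eq_square)
      ultimately have "ennreal (c\<^sup>2 / 2 * y * (1 / x)) \<le> F (x, y)"
        unfolding F_def by (simp add: ennreal_leI)
      then show ?thesis
        using True x y by (simp add: ennreal_mult[symmetric])
    qed simp
    have "(\<integral>\<^sup>+x. ennreal (1 / x) * indicator {a..y} x \<partial>lborel) = ennreal (ln y - ln a)"
      by (rule nn_integral_FTC_Icc) (use a in \<open>auto intro!: DERIV_ln_divide\<close>)
    moreover have "ln y - ln a \<ge> 1 / (8 * y\<^sup>2)"
    proof -
      have "ln (1 / y) \<le> 1 / y - 1"
        using y by (intro ln_le_minus_one) simp
      moreover have "ln (1 / y) = - ln y"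
        using y by (simp add: ln_div)
      moreover have "1 / y \<le> 1 / (8 * y\<^sup>2)"
        using y r by (simp add: field_simps power2_eq_square)
      moreover have "ln a = - 2 * (1 / (8 * y\<^sup>2))"
        by (simp add: a_def)
      ultimately show ?thesis by linarith
    qed
    ultimately have "ennreal (1 / (8 * y\<^sup>2)) \<le> (\<integral>\<^sup>+x. ennreal (1 / x) * indicator {a..y} x \<partial>lborel)"
      by (simp add: ennreal_leI)
    then have "ennreal (c\<^sup>2 / 2 * y) * ennreal (1 / (8 * y\<^sup>2))
        \<le> ennreal (c\<^sup>2 / 2 * y) * (\<integral>\<^sup>+x. ennreal (1 / x) * indicator {a..y} x \<partial>lborel)"
      by (rule mult_left_mono) simp
    also have "\<dots> = (\<integral>\<^sup>+x. ennreal (c\<^sup>2 / 2 * y) * (ennreal (1 / x) * indicator {a..y} x) \<partial>lborel)"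
      by (rule nn_integral_cmult[symmetric]) measurable
    also have "\<dots> \<le> (\<integral>\<^sup>+x. F (x, y) \<partial>lborel)"
      using pointwise by (rule nn_integral_mono)
    finally have "ennreal (c\<^sup>2 / 2 * y) * ennreal (1 / (8 * y\<^sup>2)) \<le> (\<integral>\<^sup>+x. F (x, y) \<partial>lborel)" .
    moreover have "ennreal (c\<^sup>2 / 2 * y) * ennreal (1 / (8 * y\<^sup>2)) = ennreal (c\<^sup>2 / 2 * y * (1 / (8 * y\<^sup>2)))"
      by (rule ennreal_mult[symmetric]) (use y in auto)
    moreover have "c\<^sup>2 / 2 * y * (1 / (8 * y\<^sup>2)) = c\<^sup>2 / 16 * (1 / y)"
      using y by (simp add: power2_eq_square)
    ultimately show ?thesis by simp
  qed
  have "\<infinity> = ennreal (c\<^sup>2 / 16) * (\<integral>\<^sup>+y. ennreal (1 / y) * indicator {0<..r/2} y \<partial>lborel)"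
    using r c by (simp add: nn_integral_inverse_infinite ennreal_mult_top)
  also have "\<dots> = (\<integral>\<^sup>+y. ennreal (c\<^sup>2 / 16) * (ennreal (1 / y) * indicator {0<..r/2} y) \<partial>lborel)"
    by (rule nn_integral_cmult[symmetric]) measurable
  also have "\<dots> \<le> (\<integral>\<^sup>+y. \<integral>\<^sup>+x. F (x, y) \<partial>lborel \<partial>lborel)"
  proof (rule nn_integral_mono)
    fix y :: real
    show "ennreal (c\<^sup>2 / 16) * (ennreal (1 / y) * indicator {0<..r/2} y) \<le> (\<integral>\<^sup>+x. F (x, y) \<partial>lborel)"
    proof (cases "y \<in> {0<..r/2}")
      case True
      then have "ennreal (c\<^sup>2 / 16 * (1 / y)) = ennreal (c\<^sup>2 / 16) * ennreal (1 / y)"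
        by (intro ennreal_mult) auto
      with inner[of y] True show ?thesis by simp
    qed simp
  qed
  also have "\<dots> = (\<integral>\<^sup>+p. F p \<partial>lborel)"
    using lborel_pair.nn_integral_snd[OF F_meas] by (simp add: lborel_prod)
  finally show ?thesis
    by (simp add: F_def top.extremum_unique)
qed

text \<open>Fatou's lemma would make the infinite integral at the exponent \<open>-1/2\<close> finite.\<close>

lemma Zeta_bump_unbounded:
  assumes r: "0 < r" "r \<le> 1/4" and test: "bump r \<in> test_functions U"
  shows "\<not> Bseq (\<lambda>n. Zeta f (bump r) (complex_of_real (test_exponent n)))"
proof
  assume "Bseq (\<lambda>n. Zeta f (bump r) (complex_of_real (test_exponent n)))"
  then obtain K where K: "\<And>n. norm (Zeta f (bump r) (complex_of_real (test_exponent n))) \<le> K"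
    unfolding Bseq_def by blast
  have [measurable]: "bump r \<in> borel_measurable borel"
    by (rule borel_measurable_continuous_onI[OF test_functions_continuous[OF test]])
  have "(\<lambda>n. ennreal (f p powr test_exponent n * bump r p)) \<longlonglongrightarrow> ennreal (f p powr (-1/2) * bump r p)" for p
  proof (cases "f p = 0")
    case False
    then show ?thesis
      by (intro tendsto_ennrealI tendsto_mult tendsto_powr tendsto_const test_exponent)
  qed simp
  then have "(\<integral>\<^sup>+p. ennreal (f p powr (-1/2) * bump r p) \<partial>lborel)
      = (\<integral>\<^sup>+p. liminf (\<lambda>n. ennreal (f p powr test_exponent n * bump r p)) \<partial>lborel)"
    by (intro nn_integral_cong lim_imp_Liminf[symmetric]) simp_all
  also have "\<dots> \<le> liminf (\<lambda>n. \<integral>\<^sup>+p. ennreal (f p powr test_exponent n * bump r p) \<partial>lborel)"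
    by (rule nn_integral_liminf) measurable
  also have "\<dots> \<le> limsup (\<lambda>n. \<integral>\<^sup>+p. ennreal (f p powr test_exponent n * bump r p) \<partial>lborel)"
    by (rule Liminf_le_Limsup) simp
  also have "\<dots> \<le> ennreal K"
    by (rule Limsup_bounded)
      (simp add: norm_Zeta_of_real[OF test bump_nonneg test_exponent(2), symmetric] ennreal_leI K)
  finally show False
    unfolding mass_at_critical_exponent_infinite[OF r] by (simp add: top.extremum_unique)
qed

text \<open>
  The bound on the mass holds for every strip; the width \<open>\<eta>\<close> is fixed before the exponent tends
  to \<open>-1/2\<close>.
\<close>

lemma Zeta_bump_slower_than_pole:
  assumes r: "0 < r" "r \<le> 1" and test: "bump r \<in> test_functions U"
  shows "(\<lambda>n. (complex_of_real (test_exponent n) + 1/2) * Zeta f (bump r) (complex_of_real (test_exponent n))) \<longlonglongrightarrow> 0"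
proof (rule tendstoI)
  fix \<epsilon> :: real assume \<epsilon>: "0 < \<epsilon>"
  define \<eta> where "\<eta> = min 1 (\<epsilon> / 2)"
  have \<eta>: "0 < \<eta>" "\<eta> \<le> 1" "\<eta>\<^sup>2 \<le> \<epsilon> / 2"
  proof -
    show "0 < \<eta>" "\<eta> \<le> 1" using \<epsilon> by (auto simp: \<eta>_def)
    then have "\<eta>\<^sup>2 \<le> \<eta>" by (simp add: power2_eq_square mult_le_cancel_left1)
    also have "\<eta> \<le> \<epsilon> / 2" by (simp add: \<eta>_def)
    finally show "\<eta>\<^sup>2 \<le> \<epsilon> / 2" .
  qed
  define E where "E = 4 * exp_tail 0 (\<eta>\<^sup>2) powr (-1/2)"
  have bound: "norm ((complex_of_real (test_exponent n) + 1/2) * Zeta f (bump r) (complex_of_real (test_exponent n)))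
      \<le> \<eta>\<^sup>2 + (test_exponent n + 1/2) * E" for n
  proof -
    define \<delta> where "\<delta> = test_exponent n + 1/2"
    have \<delta>: "0 < \<delta>" "\<delta> < 1/2" "test_exponent n = \<delta> - 1/2"
      by (auto simp: \<delta>_def test_exponent_def)
    have "ennreal (norm (Zeta f (bump r) (complex_of_real (test_exponent n))))
        = (\<integral>\<^sup>+p. ennreal (f p powr test_exponent n * bump r p) \<partial>lborel)"
      by (rule norm_Zeta_of_real[OF test bump_nonneg test_exponent(2)])
    also have "\<dots> \<le> ennreal (\<eta>\<^sup>2 / \<delta> + E)"
      unfolding E_def \<delta>(3) using r \<eta> \<delta> by (intro mass_near_critical_exponent) auto
    finally have "norm (Zeta f (bump r) (complex_of_real (test_exponent n))) \<le> \<eta>\<^sup>2 / \<delta> + E"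
      by (subst (asm) ennreal_le_iff) (use \<delta> in \<open>auto simp: E_def\<close>)
    then have "\<delta> * norm (Zeta f (bump r) (complex_of_real (test_exponent n))) \<le> \<delta> * (\<eta>\<^sup>2 / \<delta> + E)"
      using \<delta> by (intro mult_left_mono) auto
    also have "\<dots> = \<eta>\<^sup>2 + \<delta> * E"
      using \<delta> by (simp add: distrib_left)
    finally have "\<delta> * norm (Zeta f (bump r) (complex_of_real (test_exponent n))) \<le> \<eta>\<^sup>2 + \<delta> * E" .
    moreover have "complex_of_real (test_exponent n) + 1/2 = complex_of_real \<delta>"
      by (simp add: \<delta>_def)
    ultimately show ?thesis
      using \<delta> by (simp add: norm_mult flip: \<delta>_def)
  qed
  have "(\<lambda>n. (test_exponent n + 1/2) * E) \<longlonglongrightarrow> (-1/2 + 1/2) * E"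
    by (intro tendsto_intros test_exponent)
  then have "\<forall>\<^sub>F n in sequentially. (test_exponent n + 1/2) * E < \<epsilon> / 2"
    by (rule order_tendstoD) (use \<epsilon> in simp)
  then show "\<forall>\<^sub>F n in sequentially.
      dist ((complex_of_real (test_exponent n) + 1/2) * Zeta f (bump r) (complex_of_real (test_exponent n))) 0 < \<epsilon>"
  proof eventually_elim
    case (elim n)
    then have "norm ((complex_of_real (test_exponent n) + 1/2) *
        Zeta f (bump r) (complex_of_real (test_exponent n))) < \<epsilon>"
      using bound[of n] \<eta>(3) by linarith
    then show ?case by simp
  qed
qed

text \<open>
  A continuation to \<open>Re s > - \<rho>\<close> with \<open>\<rho> > 1/2\<close> would be meromorphic at \<open>-1/2\<close> and, by the identity
  theorem, equal to the convergent integral along the exponents tending to \<open>-1/2\<close>. There the integral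
  is unbounded, but too small for a pole.
\<close>

lemma m0_test_bump_le:
  assumes r: "0 < r" "r \<le> 1/4" and test: "bump r \<in> test_functions U"
  shows "m0_test f (bump r) \<le> ereal (1/2)"
proof -
  have "\<rho> \<le> 1/2" if "meromorphically_continuable f (bump r) \<rho>" for \<rho>
  proof (rule ccontr)
    assume "\<not> \<rho> \<le> 1/2"
    obtain D F where D: "open D" "{s. Re s > - \<rho>} \<subseteq> D" and F: "F meromorphic_on D"
      and eq: "\<And>s. Re s > 0 \<Longrightarrow> F s = Zeta f (bump r) s"
      using \<open>meromorphically_continuable f (bump r) \<rho>\<close> unfolding meromorphically_continuable_def by blast
    have half: "{s. Re s > -1/2} \<subseteq> D" and z: "-1/2 \<in> D"
      using D(2) \<open>\<not> \<rho> \<le> 1/2\<close> by (auto simp: subset_eq)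
    have near: "\<forall>\<^sub>F s in at (-1/2). s \<in> {s. Re s > -1/2} \<longrightarrow> F s = Zeta f (bump r) s"
    proof (rule meromorphic_extension_eq_near[OF F D(1) Zeta_holomorphic[OF test]])
      show "open {s. Re s > -1/2}" by (rule open_halfspace_Re_gt)
      show "connected {s. Re s > -1/2}" by (intro convex_connected convex_halfspace_Re_gt)
      show "open {s. Re s > 0}" by (rule open_halfspace_Re_gt)
      have "1 \<in> {s. Re s > 0}" by simp
      then show "{s. Re s > 0} \<noteq> {}" by blast
    qed (use half z eq in auto)
    define Y where "Y = (\<lambda>n. complex_of_real (test_exponent n))"
    have "Y \<longlonglongrightarrow> complex_of_real (-1/2)"
      unfolding Y_def by (intro tendsto_of_real test_exponent)
    then have Y: "Y \<longlonglongrightarrow> -1/2" by simp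
    have Y_ne: "Y n \<noteq> -1/2" for n
    proof
      assume "Y n = -1/2"
      then have "test_exponent n = -1/2" by (metis Y_def Re_complex_of_real Re_divide_numeral uminus_complex.sel(1) one_complex.sel(1))
      with test_exponent(2)[of n] show False by simp
    qed
    have "filterlim Y (at (-1/2)) sequentially"
      using Y Y_ne by (simp add: filterlim_at)
    then have "\<forall>\<^sub>F n in sequentially. Y n \<in> {s. Re s > -1/2} \<longrightarrow> F (Y n) = Zeta f (bump r) (Y n)"
      by (rule eventually_compose_filterlim[OF near])
    then have agree: "\<forall>\<^sub>F n in sequentially. F (Y n) = Zeta f (bump r) (Y n)"
      by eventually_elim (use test_exponent(2) in \<open>simp add: Y_def\<close>)
    have "(\<lambda>n. (Y n + 1/2) * Zeta f (bump r) (Y n)) \<longlonglongrightarrow> 0"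
      using Zeta_bump_slower_than_pole[OF r(1) _ test] r(2) by (simp add: Y_def)
    then have "(\<lambda>n. (Y n - (-1/2)) * F (Y n)) \<longlonglongrightarrow> 0"
      by (rule Lim_transform_eventually) (use agree in \<open>auto elim!: eventually_mono\<close>)
    then have "Bseq (\<lambda>n. F (Y n))"
      by (intro meromorphic_Bseq_if_slower_than_pole[OF _ Y Y_ne])
        (use meromorphic_on_subset[OF F] z in auto)
    then have "Bseq (\<lambda>n. Zeta f (bump r) (Y n))"
      by (rule Bseq_eventually_mono[rotated]) (use agree in \<open>auto elim!: eventually_mono\<close>)
    then show False
      using Zeta_bump_unbounded[OF r test] by (simp add: Y_def)
  qed
  then show ?thesis
    unfolding m0_test_def by (intro SUP_least) auto
qed

lemma m0_eq_half:
  assumes "open U" "(0, 0) \<in> U"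
  shows "m0 U f = ereal (1/2)"
proof (rule antisym)
  show "ereal (1/2) \<le> m0 U f"
    unfolding m0_def using m0_test_ge by (rule INF_greatest)
  obtain e where e: "0 < e" "{-e..e} \<times> {-e..e} \<subseteq> U"
    using open_contains_square[OF assms] .
  define r where "r = min (1/4) e"
  have r: "0 < r" "r \<le> 1/4" using e by (auto simp: r_def)
  have "{-r..r} \<times> {-r..r} \<subseteq> {-e..e} \<times> {-e..e}"
    by (auto simp: r_def)
  with e(2) have "{-r..r} \<times> {-r..r} \<subseteq> U" by blast
  then have test: "bump r \<in> test_functions U"
    by (rule bump_test_function[OF r(1)])
  show "m0 U f \<le> ereal (1/2)"
    unfolding m0_def by (rule INF_lower2[where f = "m0_test f", OF test m0_test_bump_le[OF r test]])
qed

end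

section \<open>Functions that attain the bounds\<close>

definition example_C :: "real \<times> real \<Rightarrow> real" where
  "example_C = (\<lambda>(x, y). x\<^sup>2 * y\<^sup>2 + exp_tail 0 (y\<^sup>2))"

definition example_D :: "real \<times> real \<Rightarrow> real" where
  "example_D = (\<lambda>(x, y). x\<^sup>2 * y\<^sup>2 + exp_tail 0 (x\<^sup>2) + exp_tail 0 (y\<^sup>2))"

lemma fst_snd_power_in_exp_algebra:
  "(\<lambda>p. (fst p :: real) ^ n) \<in> exp_algebra" "(\<lambda>p. (snd p :: real) ^ n) \<in> exp_algebra"
  by (intro exp_algebra_power exp_algebra_coordinates)+

lemma example_C_in_exp_algebra: "example_C \<in> exp_algebra"
  unfolding example_C_def case_prod_beta
  by (intro exp_algebra.add exp_algebra.mult exp_algebra.tail fst_snd_power_in_exp_algebra)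

lemma example_D_in_exp_algebra: "example_D \<in> exp_algebra"
  unfolding example_D_def case_prod_beta
  by (intro exp_algebra.add exp_algebra.mult exp_algebra.tail fst_snd_power_in_exp_algebra)

text \<open>The flat term \<open>exp (- 1 / y\<^sup>2)\<close> is the fourth power of the lower end of the cusp.\<close>

lemma tail_le_square_mult:
  assumes "exp (- 1 / (4 * y\<^sup>2)) \<le> x" "0 < y" "x \<le> y"
  shows "exp_tail 0 (y\<^sup>2) \<le> x\<^sup>2 * y\<^sup>2"
proof -
  have x: "0 < x" using assms(1) exp_gt_zero less_le_trans by blast
  have "exp_tail 0 (y\<^sup>2) = exp (- 1 / (4 * y\<^sup>2)) ^ 4"
    using assms(2) by (simp add: exp_tail_def flip: exp_of_nat_mult)
  also have "\<dots> \<le> x ^ 4"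
    using assms(1) by (intro power_mono) auto
  also have "x ^ 4 = x\<^sup>2 * x\<^sup>2"
    by (simp flip: power_add)
  also have "\<dots> \<le> x\<^sup>2 * y\<^sup>2"
    using assms x by (intro mult_left_mono power_mono) auto
  finally show ?thesis .
qed

interpretation C: flat_perturbation example_C
proof
  show "continuous_on UNIV example_C"
    using example_C_in_exp_algebra by (rule exp_algebra_continuous)
  fix x y :: real
  show "x\<^sup>2 * y\<^sup>2 + exp_tail 0 (y\<^sup>2) \<le> example_C (x, y)"
    by (simp add: example_C_def)
  assume "exp (- 1 / (4 * y\<^sup>2)) \<le> x" "0 < y" "x \<le> y"
  then have "exp_tail 0 (y\<^sup>2) \<le> x\<^sup>2 * y\<^sup>2"
    by (rule tail_le_square_mult)
  moreover have "0 \<le> x\<^sup>2 * y\<^sup>2" by simp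
  ultimately show "example_C (x, y) \<le> 4 * (x\<^sup>2 * y\<^sup>2)"
    unfolding example_C_def prod.case by linarith
qed

interpretation D: flat_perturbation example_D
proof
  show "continuous_on UNIV example_D"
    using example_D_in_exp_algebra by (rule exp_algebra_continuous)
  fix x y :: real
  show "x\<^sup>2 * y\<^sup>2 + exp_tail 0 (y\<^sup>2) \<le> example_D (x, y)"
    by (simp add: example_D_def exp_tail_nonneg)
  assume *: "exp (- 1 / (4 * y\<^sup>2)) \<le> x" "0 < y" "x \<le> y"
  have "0 < x" using *(1) exp_gt_zero less_le_trans by blast
  then have "x\<^sup>2 * x\<^sup>2 \<le> x\<^sup>2 * y\<^sup>2"
    using * by (intro mult_left_mono power_mono) auto
  moreover have "exp_tail 0 (x\<^sup>2) \<le> 2 * (x\<^sup>2 * x\<^sup>2)"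
    using exp_tail_le[of 0 "x\<^sup>2"] by (simp add: power2_eq_square numeral_2_eq_2)
  ultimately show "example_D (x, y) \<le> 4 * (x\<^sup>2 * y\<^sup>2)"
    using tail_le_square_mult[OF *] by (simp add: example_D_def)
qed

text \<open>The gradient vanishes because \<open>f\<close> has a minimum at the origin.\<close>

lemma singular_at_origin_nonneg:
  assumes "f \<in> exp_algebra" "f (0, 0) = 0" "\<And>p. 0 \<le> f p"
  shows "singular_at_origin U f"
proof -
  obtain f' where f': "(f has_derivative f') (at (0, 0))"
    using exp_algebra_has_derivative[OF assms(1)] by blast
  moreover have "f' = (\<lambda>_. 0)"
    using f' by (rule has_derivative_local_min) (use assms(2,3) in simp)
  ultimately show ?thesis
    using assms(1,2) exp_algebra_smooth_on unfolding singular_at_origin_def by blast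
qed

lemma square_tail_in_flat_ideal:
  assumes "bounded_linear l"
  shows "(\<lambda>p. exp_tail 0 ((l p)\<^sup>2)) \<in> flat_ideal"
proof -
  have "(\<lambda>p. 1 * exp_tail 0 ((l p)\<^sup>2)) \<in> flat_ideal"
  proof (rule flat_ideal.tail)
    show "(\<lambda>p. (l p)\<^sup>2) \<in> exp_algebra"
      by (intro exp_algebra_power exp_algebra.linear assms)
    show "(l 0)\<^sup>2 = 0"
      using linear_0[OF bounded_linear.linear[OF assms]] by simp
  qed (rule exp_algebra.const)
  then show ?thesis by simp
qed

lemma square_tail_smooth_flat:
  assumes "bounded_linear l"
  shows "smooth_on S (\<lambda>p. exp_tail 0 ((l p)\<^sup>2))" "flat (\<lambda>p. exp_tail 0 ((l p)\<^sup>2))"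
  using square_tail_in_flat_ideal[OF assms]
  by (auto intro: flat_ideal_flat exp_algebra_smooth_on flat_ideal_subset_exp_algebra)

lemma zero_smooth_flat: "smooth_on S (\<lambda>_. 0 :: real)" "flat (\<lambda>_ :: 'a :: real_normed_vector. 0)"
proof -
  show "smooth_on S (\<lambda>_. 0 :: real)"
    using exp_algebra.const by (rule exp_algebra_smooth_on)
  have "(\<lambda>_. 0 * exp_tail 0 0) \<in> (flat_ideal :: ('a \<Rightarrow> real) set)"
    by (intro flat_ideal.tail exp_algebra.const) simp
  then show "flat (\<lambda>_ :: 'a. 0)"
    using flat_ideal_flat by fastforce
qed

text \<open>
  A flat function of one variable is a polynomial of degree \<open>0\<close> in the other variable; the higher
  coefficients are taken to be \<open>0\<close>.
\<close>

lemma smooth_flat_tail_coefficients: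
  assumes "0 < n"
  obtains c :: "nat \<Rightarrow> real \<Rightarrow> real" where "\<And>j. smooth_on S (c j)" "\<And>j. flat (c j)"
    "\<And>x y. (\<Sum>j<n. x ^ j * c j y) = exp_tail 0 (y\<^sup>2)"
proof
  define c where "c = (\<lambda>j::nat. if j = 0 then (\<lambda>y::real. exp_tail 0 (y\<^sup>2)) else (\<lambda>_. 0))"
  show "smooth_on S (c j)" "flat (c j)" for j
    using square_tail_smooth_flat[OF bounded_linear_ident] zero_smooth_flat by (auto simp: c_def)
  show "(\<Sum>j<n. x ^ j * c j y) = exp_tail 0 (y\<^sup>2)" for x y
  proof -
    have "(\<Sum>j<n. x ^ j * c j y) = (\<Sum>j<n. if j = 0 then exp_tail 0 (y\<^sup>2) else 0)"
      by (rule sum.cong) (auto simp: c_def)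
    then show ?thesis using assms by simp
  qed
qed

lemma flat_x_poly_tail:
  assumes "open U" "(0, 0) \<in> U" "0 < a"
  shows "flat_x_poly U a (\<lambda>p. exp_tail 0 ((snd p)\<^sup>2))"
proof -
  obtain r where r: "0 < r" "{-r..r} \<times> {-r..r} \<subseteq> U"
    using open_contains_square[OF assms(1,2)] .
  obtain c where "\<And>j. smooth_on (snd ` U) (c j)" "\<And>j. flat (c j)"
    "\<And>x y. (\<Sum>j<a. x ^ j * c j y) = exp_tail 0 (y\<^sup>2)"
    using smooth_flat_tail_coefficients[OF assms(3)] by blast
  moreover have "(r, r) \<in> U" "exp_tail 0 ((snd (r, r))\<^sup>2) \<noteq> 0"
    using r by (auto simp: exp_tail_def)
  ultimately show ?thesis
    unfolding flat_x_poly_def using square_tail_smooth_flat[OF bounded_linear_snd]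
    by (intro conjI bexI[of _ "(r, r)"] exI[of _ c]) auto
qed

lemma flat_y_poly_tail:
  assumes "open U" "(0, 0) \<in> U" "0 < b"
  shows "flat_y_poly U b (\<lambda>p. exp_tail 0 ((fst p)\<^sup>2))"
proof -
  obtain r where r: "0 < r" "{-r..r} \<times> {-r..r} \<subseteq> U"
    using open_contains_square[OF assms(1,2)] .
  obtain c where "\<And>j. smooth_on (fst ` U) (c j)" "\<And>j. flat (c j)"
    "\<And>y x. (\<Sum>j<b. y ^ j * c j x) = exp_tail 0 (x\<^sup>2)"
    using smooth_flat_tail_coefficients[OF assms(3)] by blast
  moreover have "(r, r) \<in> U" "exp_tail 0 ((fst (r, r))\<^sup>2) \<noteq> 0"
    using r by (auto simp: exp_tail_def)
  ultimately show ?thesis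
    unfolding flat_y_poly_def using square_tail_smooth_flat[OF bounded_linear_fst]
    by (intro conjI bexI[of _ "(r, r)"] exI[of _ c]) auto
qed

lemma one_smooth: "smooth_on S (\<lambda>_. 1 :: real)"
  using exp_algebra.const by (rule exp_algebra_smooth_on)

lemma case_C_example:
  assumes "open U" "(0, 0) \<in> U"
  shows "case_C U 2 2 example_C"
proof -
  have "singular_at_origin U example_C"
    using example_C_in_exp_algebra _ C.nonneg by (rule singular_at_origin_nonneg) (simp add: example_C_def)
  moreover have "\<exists>v h. smooth_on U v \<and> v (0, 0) \<noteq> 0 \<and> flat_x_poly U 2 h \<and>
      (\<forall>(x, y)\<in>U. example_C (x, y) = v (x, y) * x ^ 2 * y ^ 2 + h (x, y))"
    by (rule exI[of _ "\<lambda>_. 1"], rule exI[of _ "\<lambda>p. exp_tail 0 ((snd p)\<^sup>2)"])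
      (auto simp: example_C_def intro!: one_smooth flat_x_poly_tail assms)
  ultimately show ?thesis
    unfolding case_C_def by blast
qed

lemma case_D_example:
  assumes "open U" "(0, 0) \<in> U"
  shows "case_D U 2 2 example_D"
proof -
  have "singular_at_origin U example_D"
    using example_D_in_exp_algebra _ D.nonneg by (rule singular_at_origin_nonneg) (simp add: example_D_def)
  moreover have "\<exists>v g h. smooth_on U v \<and> v (0, 0) \<noteq> 0 \<and> flat_y_poly U 2 g \<and> flat_x_poly U 2 h \<and>
      (\<forall>(x, y)\<in>U. example_D (x, y) = v (x, y) * x ^ 2 * y ^ 2 + g (x, y) + h (x, y))"
    by (rule exI[of _ "\<lambda>_. 1"], rule exI[of _ "\<lambda>p. exp_tail 0 ((fst p)\<^sup>2)"],
        rule exI[of _ "\<lambda>p. exp_tail 0 ((snd p)\<^sup>2)"])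
      (auto simp: example_D_def intro!: one_smooth flat_x_poly_tail flat_y_poly_tail assms)
  ultimately show ?thesis
    unfolding case_D_def by blast
qed

theorem theorem3p8:
  shows "(\<exists>(a::nat) (b::nat) (f :: real \<times> real \<Rightarrow> real).
            for_small_nbhds (\<lambda>U. case_C U a b f \<and> m0 U f = ereal (1 / real a))) \<and>
         (\<exists>(a::nat) (b::nat) (f :: real \<times> real \<Rightarrow> real).
            for_small_nbhds (\<lambda>U. case_D U a b f \<and> m0 U f = ereal (1 / real b)))"
proof (intro conjI exI)
  show "for_small_nbhds (\<lambda>U. case_C U 2 2 example_C \<and> m0 U example_C = ereal (1 / real 2))"
    unfolding for_small_nbhds_def using case_C_example C.m0_eq_half by (intro exI[of _ UNIV]) auto
  show "for_small_nbhds (\<lambda>U. case_D U 2 2 example_D \<and> m0 U example_D = ereal (1 / real 2))"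
    unfolding for_small_nbhds_def using case_D_example D.m0_eq_half by (intro exI[of _ UNIV]) auto
qed

end
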